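(* Let $k,\ell$ be non-negative integers and let $a\in\mathbb{C}$ be general ($a\notin\mathbb{Z}$). Then, for $z$ in a neighborhood of $1$, $${}_2F_1\!\left(\tfrac{a}{2},\,\tfrac{a+1}{2}+\ell;\;a+k+\ell+1;\;1-z\right)= z^{k/2}\left(\frac{1+\sqrt{z}}{2}\right)^{-a-k-\ell} F_3\!\left(k+1,\ell+1;\,-k,-\ell;\;a+k+\ell+1;\;\frac{\sqrt{z}-1}{2\sqrt{z}},\frac{1-\sqrt{z}}{2}\right),$$ and, for $z$ in a neighborhood of $0$, $$\frac{\left(\frac{a+1}{2}\right)_\ell}{\left(\frac12\right)_\ell}\;{}_2F_1\!\left(\tfrac{a}{2},\tfrac{a+1}{2}+\ell;\;\tfrac12-k;\;z\right)=\frac{(1+\sqrt{z})^{-a}}{2}\,F_2\!\left(a;-k,-\ell;-2k,-2\ell;\frac{2\sqrt{z}}{1+\sqrt{z}},\frac{2}{1+\sqrt{z}}\right)+\frac{(1-\sqrt{z})^{-a}}{2}\,F_2\!\left(a;-k,-\ell;-2k,-2\ell;\frac{2\sqrt{z}}{\sqrt{z}-1},\frac{2}{1-\sqrt{z}}\right),$$ and $$\frac{\left(\frac{a+1}{2}\right)_k\left(\frac{a}{2}\right)_{k+\ell+1}}{\left(\frac12\right)_k\left(\frac12\right)_{k+1}\left(\frac12\right)_\ell}\,(-1)^k z^{k+\frac12}\;{}_2F_1\!\left(\tfrac{a+1}{2}+k,\,\tfrac{a}{2}+k+\ell+1;\;\tfrac32+k;\;z\right)=\frac{(1-\sqrt{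z})^{-a}}{2}\,F_2\!\left(a;-k,-\ell;-2k,-2\ell;\frac{2\sqrt{z}}{\sqrt{z}-1},\frac{2}{1-\sqrt{z}}\right)-\frac{(1+\sqrt{z})^{-a}}{2}\,F_2\!\left(a;-k,-\ell;-2k,-2\ell;\frac{2\sqrt{z}}{1+\sqrt{z}},\frac{2}{1+\sqrt{z}}\right).$$
   Context: $(a)_n=a(a+1)\cdots(a+n-1)$ is the Pochhammer symbol, with $(a)_0=1$. ${}_2F_1(A,B;C;z)=\sum_{n\ge0}\frac{(A)_n(B)_n}{(C)_n\,n!}z^n$ is the Gauss hypergeometric function. Appell's bivariate series are $$F_2(a;b_1,b_2;c_1,c_2;x,y)=\sum_{p\ge0}\sum_{q\ge0}\frac{(a)_{p+q}(b_1)_p(b_2)_q}{(c_1)_p(c_2)_q\,p!\,q!}x^py^q,\qquad F_3(a_1,a_2;b_1,b_2;c;x,y)=\sum_{p\ge0}\sum_{q\ge0}\frac{(a_1)_p(a_2)_q(b_1)_p(b_2)_q}{(c)_{p+q}\,p!\,q!}x^py^q.$$ Convention: whenever $b_1=-k$, $b_2=-\ell$ with non-negative integers $k,\ell$, these denote the finite sums over $0\le p\le k$, $0\le q\le\ell$ (so $(k+1)(\ell+1)$ terms); in particular $F_2(a;-k,-\ell;-2k,-2\ell;x,y)$ is well defined as this finite sum. Branches: in the first identity $\sqrt z$ is the branch with $\sqrt1=1$, $z^{k/2}=(\sqrt z)^k$, and the complex power is principal (equal to $1$ at $z=1$). In the second and third identities $\sqrt z$ is either fixed value of the square root of $z$ with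 $|z|<1$, $z^{k+1/2}=(\sqrt z)^{2k+1}$, and $(1\pm\sqrt z)^{-a}$ are principal powers (equal to $1$ at $z=0$). *)

theory Defs
  imports "HOL-Analysis.Analysis"
begin

definition gauss_2F1 :: "complex \<Rightarrow> complex \<Rightarrow> complex \<Rightarrow> complex \<Rightarrow> complex" where
  "gauss_2F1 A B C z =
     (\<Sum>n. pochhammer A n * pochhammer B n / (pochhammer C n * fact n) * z ^ n)"

lemma gauss_2F1_eq_eval_fps:
  "gauss_2F1 A B C z = eval_fps (fps_hypergeo [A, B] [C] 1) z"
  by (simp add: gauss_2F1_def eval_fps_def)

(* Terminating Appell series: the parameters k and l stand for b1 = -k and b2 = -l, and the
   sums run over p <= k and q <= l. Terms beyond this range are left out by definition, so that
   c1, c2 may be negative integers as long as (c1)_p and (c2)_q do not vanish within it. *)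

definition appell_F2 ::
  "complex \<Rightarrow> nat \<Rightarrow> nat \<Rightarrow> complex \<Rightarrow> complex \<Rightarrow> complex \<Rightarrow> complex \<Rightarrow> complex" where
  "appell_F2 a k l c1 c2 x y =
     (\<Sum>p\<le>k. \<Sum>q\<le>l.
        pochhammer a (p + q) * pochhammer (- of_nat k) p * pochhammer (- of_nat l) q
        / (pochhammer c1 p * pochhammer c2 q * fact p * fact q) * x ^ p * y ^ q)"

definition appell_F3 ::
  "complex \<Rightarrow> complex \<Rightarrow> nat \<Rightarrow> nat \<Rightarrow> complex \<Rightarrow> complex \<Rightarrow> complex \<Rightarrow> complex" where
  "appell_F3 a1 a2 k l c x y =
     (\<Sum>p\<le>k. \<Sum>q\<le>l.
        pochhammer a1 p * pochhammer a2 q * pochhammer (- of_nat k) p * pochhammer (- of_nat l) q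
        / (pochhammer c (p + q) * fact p * fact q) * x ^ p * y ^ q)"

end

theory Submission
  imports Defs "HOL-Complex_Analysis.Complex_Analysis"
begin

text \<open>
  Write \<open>s = \<surd>z\<close>. All three identities are about the function
  \<open>G_a(s) = (1 + s)^(-a) F2(a; -k, -l; -2k, -2l; 2s/(1+s), 2/(1+s))\<close>.

  Its Taylor series at \<open>s = 0\<close> is explicit. Expanding all powers of \<open>1 + s\<close>, the coefficient of
  \<open>s^n\<close> factors into \<open>(-1)^n (a)_n / n!\<close> times the two terminating Gauss sums
  \<open>2F1(-k, -n; -2k; 2)\<close> and \<open>2F1(-l, a+n; -2l; 2)\<close>, and these have the closed forms
  \<open>((1-n)/2)_k / (1/2)_k\<close> and \<open>((a+n+1)/2)_l / (1/2)_l\<close> (lemmas \<open>sum_gauss_at_2_term\<close> and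
  \<open>appell_F2_sums\<close>). The even part of \<open>G_a\<close> is the left-hand side of the second identity. In the odd
  part the coefficients below \<open>s^(2k+1)\<close> vanish because of the factor \<open>((1-n)/2)_k\<close>, and what remains
  is, up to sign, the left-hand side of the third identity.

  For the first identity, reversing both summations shows that the F3 series is an F2 series with \<open>a\<close>
  replaced by \<open>a' = -a-2k-2l\<close>, so that on the unit disc the right-hand side is a constant multiple of
  \<open>(1-s^2)^(-a-k-l) G_a'(-s)\<close> (lemma \<open>F3_cleared_eq_appell_F2\<close>). The coefficients of
  \<open>G_a'\<close> obey a two-term recurrence, hence \<open>G_a'(-s)\<close> satisfies a second-order differential equation,
  and multiplication by \<open>(1-s^2)^(-a-k-l)\<close> turns it into the equation with \<open>a\<close> in place of
  \<open>a'\<close>; this is Euler's transformation, carried out on the equation instead of the solutions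
  (lemma \<open>s_operator_gauge\<close>). The right-hand side is holomorphic for \<open>Re s > -1\<close>, so by the identity
  theorem the equation holds near \<open>s = 1\<close> too. In the variable \<open>1 - s^2 = 1 - z\<close> it is the Gauss
  equation of the left-hand side. Since \<open>a + k + l + 1\<close> is not an integer, that equation has exactly
  one holomorphic solution at the origin with value 1 (lemma \<open>hypergeometric_ode_unique\<close>), and the right-hand
  side has value 1 at \<open>z = 1\<close>.
\<close>

section \<open>A terminating Gauss sum at argument 2\<close>

lemma of_nat_add_one_nz: "of_nat n + 1 \<noteq> (0 :: complex)"
  by (metis of_nat_Suc add.commute of_nat_neq_0)

text \<open>
  The summand of the terminating series \<open>2F1(-l, b; -2l; 2)\<close>.
\<close>

definition gauss_at_2_term :: "complex \<Rightarrow> nat \<Rightarrow> nat \<Rightarrow> complex" where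
  "gauss_at_2_term b l q = pochhammer (- of_nat l) q * pochhammer b q
     / (pochhammer (- 2 * of_nat l) q * fact q) * 2 ^ q"

lemma pochhammer_shift: "pochhammer x n * (x + of_nat n) = x * pochhammer (x + 1 :: complex) n"
  by (metis pochhammer_Suc pochhammer_rec)

lemma pochhammer_minus_double_nz:
  assumes "p \<le> k" shows "pochhammer (- 2 * of_nat k :: complex) p \<noteq> 0"
proof -
  have "- 2 * of_nat k = - (of_nat (2 * k) :: complex)" by simp
  then show ?thesis using assms pochhammer_of_nat_eq_0_iff[of "2*k" p, where ?'a = complex] by simp
qed

lemma pochhammer_half_nz: "pochhammer (1 / 2 :: complex) n \<noteq> 0"
proof
  assume "pochhammer (1 / 2 :: complex) n = 0"
  then obtain j where "(1/2 :: complex) = - of_nat j" by (auto simp: pochhammer_eq_0_iff)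
  then have "Re (1/2 :: complex) = Re (- of_nat j :: complex)" by (rule arg_cong)
  then show False by simp
qed

text \<open>
  This relation and the next one are the ingredients of a creative-telescoping argument in \<open>l\<close>: they
  compare neighbouring summands in such a way that suitably weighted partial sums for \<open>l + 1\<close> and
  \<open>l\<close> differ by a single boundary term.
\<close>

lemma gauss_at_2_term_Suc_Suc:
  assumes "N \<le> l"
  shows "(2 * of_nat l + 1) * (of_nat N + 1) * gauss_at_2_term b (Suc l) (Suc N)
       = (b + of_nat N) * (2 * of_nat l + 1 - of_nat N) * gauss_at_2_term b l N"
proof -
  let ?L = "of_nat l :: complex" and ?N = "of_nat N :: complex"
  let ?D = "pochhammer (- 2 * ?L) N" and ?D' = "pochhammer (- 2 * ?L - 1) N"
  have nz: "?D \<noteq> 0" using pochhammer_minus_double_nz[OF assms] .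
  have r: "?D' * (2 * ?L + 1 - ?N) = (2 * ?L + 1) * ?D"
    using pochhammer_shift[of "- 2 * ?L - 1" N] by (simp add: algebra_simps)
  have l1: "2 * ?L + 1 \<noteq> 0" using of_nat_add_one_nz[of "2 * l"] by simp
  have l2: "?L + 1 \<noteq> 0" by (rule of_nat_add_one_nz)
  have n1: "?N + 1 \<noteq> 0" by (rule of_nat_add_one_nz)
  have nz': "?D' \<noteq> 0" using r nz l1 by auto
  have l2': "- (2 * ?L) \<noteq> 2"
  proof
    assume "- (2 * ?L) = 2"
    then have "2 * ?L = - 2" by (metis minus_minus)
    then have "2 * (?L + 1) = 0" by (simp add: distrib_left)
    with l2 show False by (metis mult_eq_0_iff zero_neq_numeral)
  qed
  have e1: "pochhammer (- of_nat (Suc l) :: complex) (Suc N) = - (?L + 1) * pochhammer (- ?L) N"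
    by (simp add: pochhammer_rec algebra_simps)
  have e2: "pochhammer (- 2 * of_nat (Suc l) :: complex) (Suc N) = - (2 * (?L + 1)) * ?D'"
  proof -
    have eqs: "- 2 * of_nat (Suc l) = - 2 * ?L - 2" "- 2 * ?L - 2 + 1 = - 2 * ?L - 1" by simp_all
    show ?thesis unfolding eqs(1) pochhammer_rec eqs(2) by algebra
  qed
  have "gauss_at_2_term b (Suc l) (Suc N)
      = (- (?L + 1) * pochhammer (- ?L) N) * (pochhammer b N * (b + ?N))
        / (- (2 * (?L + 1)) * ?D' * ((?N + 1) * fact N)) * (2 * 2 ^ N)"
    unfolding gauss_at_2_term_def e1 e2 by (simp add: pochhammer_Suc algebra_simps)
  also have "\<dots> = (b + ?N) * (pochhammer (- ?L) N * pochhammer b N * 2 ^ N) / (?D' * (?N + 1) * fact N)"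
    using l2' n1 nz' by (simp add: divide_simps)
  finally have A: "(?N + 1) * gauss_at_2_term b (Suc l) (Suc N)
      = (b + ?N) * (pochhammer (- ?L) N * pochhammer b N * 2 ^ N) / (?D' * fact N)"
    using n1 nz' by (simp add: divide_simps mult_ac)
  have B: "(2 * ?L + 1) / ?D' = (2 * ?L + 1 - ?N) / ?D"
    using r nz nz' by (simp add: divide_simps mult.commute)
  have "(2 * ?L + 1) * (?N + 1) * gauss_at_2_term b (Suc l) (Suc N)
      = (b + ?N) * (pochhammer (- ?L) N * pochhammer b N * 2 ^ N) / fact N * ((2 * ?L + 1) / ?D')"
    unfolding mult.assoc[of "2 * ?L + 1"] A by (simp only: divide_inverse inverse_mult_distrib mult_ac)
  also have "\<dots> = (b + ?N) * (2 * ?L + 1 - ?N) * gauss_at_2_term b l N"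
    unfolding B gauss_at_2_term_def by (simp only: divide_inverse inverse_mult_distrib mult_ac)
  finally show ?thesis .
qed

lemma gauss_at_2_term_ratio:
  assumes "N < l"
  shows "(2 * of_nat l - of_nat N) * (of_nat N + 1) * gauss_at_2_term b l (Suc N)
       = 2 * (of_nat l - of_nat N) * (b + of_nat N) * gauss_at_2_term b l N"
proof -
  let ?L = "of_nat l :: complex" and ?N = "of_nat N :: complex"
  have nz: "pochhammer (- 2 * ?L) N \<noteq> 0" "pochhammer (- 2 * ?L) (Suc N) \<noteq> 0"
    using assms by (intro pochhammer_minus_double_nz; simp)+
  have n1: "?N + 1 \<noteq> 0" by (rule of_nat_add_one_nz)
  have d: "- 2 * ?L + ?N \<noteq> 0" using nz(2) by (simp add: pochhammer_Suc)
  have "gauss_at_2_term b l (Suc N)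
      = 2 * (- ?L + ?N) * (b + ?N) / ((- 2 * ?L + ?N) * (?N + 1)) * gauss_at_2_term b l N"
    unfolding gauss_at_2_term_def pochhammer_Suc using nz(1) n1 d
    by (simp add: divide_simps) (simp add: algebra_simps)
  moreover have "(- 2 * ?L + ?N) * (?N + 1) \<noteq> 0" using d n1 by simp
  ultimately have "(- 2 * ?L + ?N) * (?N + 1) * gauss_at_2_term b l (Suc N)
     = 2 * (- ?L + ?N) * (b + ?N) * gauss_at_2_term b l N"
    by simp
  then show ?thesis by algebra
qed

text \<open>
  The boundary term \<open>(b + N) t(l, N)\<close> is the telescoping certificate. It is a multiple of the last summand
  included, and at \<open>N = l\<close> it is exactly absorbed by the additional summand with index \<open>l + 1\<close> on
  the left-hand side.
\<close>

lemma gauss_at_2_term_partial_sum: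
  assumes "N \<le> l"
  shows "(2 * of_nat l + 1) * (\<Sum>q\<le>N. gauss_at_2_term b (Suc l) q)
       = (b + 1 + 2 * of_nat l) * (\<Sum>q\<le>N. gauss_at_2_term b l q) - (b + of_nat N) * gauss_at_2_term b l N"
  using assms
proof (induction N)
  case 0
  show ?case by (simp add: gauss_at_2_term_def)
next
  case (Suc N)
  let ?L = "of_nat l :: complex" and ?N = "of_nat N :: complex"
  have n1: "?N + 1 \<noteq> 0" by (rule of_nat_add_one_nz)
  have "(?N + 1) * ((2 * ?L + 1) * gauss_at_2_term b (Suc l) (Suc N))
      = (?N + 1) * ((2 * ?L - ?N) * gauss_at_2_term b l (Suc N) + (b + ?N) * gauss_at_2_term b l N)"
    using gauss_at_2_term_Suc_Suc[of N l b] gauss_at_2_term_ratio[of N l b] Suc.prems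
    by (simp only: Suc_le_eq less_imp_le) algebra
  then have "(2 * ?L + 1) * gauss_at_2_term b (Suc l) (Suc N)
      = (2 * ?L - ?N) * gauss_at_2_term b l (Suc N) + (b + ?N) * gauss_at_2_term b l N"
    using n1 by (metis mult_left_cancel)
  moreover have "(2 * ?L + 1) * (\<Sum>q\<le>N. gauss_at_2_term b (Suc l) q)
       = (b + 1 + 2 * ?L) * (\<Sum>q\<le>N. gauss_at_2_term b l q) - (b + ?N) * gauss_at_2_term b l N"
    using Suc by simp
  ultimately show ?case by (simp only: sum.atMost_Suc of_nat_Suc) algebra
qed

text \<open>
  Both sides satisfy the same first-order recurrence in \<open>l\<close>, with ratio
  \<open>(b + 1 + 2l) / (1 + 2l)\<close>. The closed form is what makes the Appell series below accessible: it holds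
  because the lower parameter is exactly twice the upper one.
\<close>

lemma sum_gauss_at_2_term:
  "(\<Sum>q\<le>l. gauss_at_2_term b l q) = pochhammer ((b + 1) / 2) l / pochhammer (1 / 2) l"
proof (induction l)
  case 0
  show ?case by (simp add: gauss_at_2_term_def)
next
  case (Suc l)
  let ?L = "of_nat l :: complex"
  have l1: "2 * ?L + 1 \<noteq> 0" using of_nat_add_one_nz[of "2 * l"] by simp
  have l2: "?L + 1 \<noteq> 0" by (rule of_nat_add_one_nz)
  have "(?L + 1) * ((2 * ?L + 1) * gauss_at_2_term b (Suc l) (Suc l)) = (?L + 1) * ((b + ?L) * gauss_at_2_term b l l)"
    using gauss_at_2_term_Suc_Suc[of l l b] by (simp add: algebra_simps)
  then have "(2 * ?L + 1) * gauss_at_2_term b (Suc l) (Suc l) = (b + ?L) * gauss_at_2_term b l l"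
    using l2 by (metis mult_left_cancel)
  then have "(2 * ?L + 1) * (\<Sum>q\<le>Suc l. gauss_at_2_term b (Suc l) q)
      = (b + 1 + 2 * ?L) * (\<Sum>q\<le>l. gauss_at_2_term b l q)"
    using gauss_at_2_term_partial_sum[of l l b] by (simp add: algebra_simps)
  then have "(\<Sum>q\<le>Suc l. gauss_at_2_term b (Suc l) q)
      = (b + 1 + 2 * ?L) / (2 * ?L + 1) * (\<Sum>q\<le>l. gauss_at_2_term b l q)"
    using l1 by (simp add: divide_simps mult.commute)
  also have "\<dots> = pochhammer ((b + 1) / 2) (Suc l) / pochhammer (1 / 2) (Suc l)"
    unfolding Suc.IH pochhammer_Suc using l1 pochhammer_half_nz[of l] by (simp add: divide_simps) (simp add: algebra_simps)
  finally show ?case .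
qed

section \<open>The Appell F2 side as an explicit power series\<close>

text \<open>
  The Taylor coefficient at \<open>s = 0\<close> of
  \<open>(1 + s)^(-a) F2(a; -k, -l; -2k, -2l; 2s/(1+s), 2/(1+s))\<close>. The two quotients of Pochhammer symbols are
  the values of \<open>2F1(-k, -n; -2k; 2)\<close> and \<open>2F1(-l, a+n; -2l; 2)\<close>.
\<close>

definition F2_coeff :: "complex \<Rightarrow> nat \<Rightarrow> nat \<Rightarrow> nat \<Rightarrow> complex" where
  "F2_coeff a k l n = (- 1) ^ n * pochhammer a n / fact n
     * (pochhammer ((1 - of_nat n) / 2) k / pochhammer (1 / 2) k)
     * (pochhammer ((a + of_nat n + 1) / 2) l / pochhammer (1 / 2 :: complex) l)"

text \<open>
  The binomial series for \<open>(1 + s)^(-a-p-q)\<close>, multiplied by \<open>(a)_(p+q) s^p\<close> and reindexed so that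
  the power of \<open>s\<close> is \<open>n\<close>. In this form the dependence on \<open>p\<close> sits in
  \<open>(-n)_p\<close>, which vanishes for \<open>n < p\<close>, and the dependence on \<open>q\<close> in
  \<open>(a)_(n+q)\<close>, so the two summation indices are decoupled.
\<close>

lemma shifted_binomial_sums:
  fixes s a :: complex
  assumes "norm s < 1"
  shows "(\<lambda>n. (- 1) ^ n / fact n * pochhammer (- of_nat n) p * pochhammer a (n + q) * s ^ n)
           sums (pochhammer a (p + q) * s ^ p * (1 + s) powr (- a - of_nat p - of_nat q))"
    (is "?f sums _")
proof -
  let ?b = "a + of_nat p + of_nat q"
  have zero: "?f n = 0" if "n \<notin> range (\<lambda>m. m + p)" for n
  proof -
    have "n < p" by (metis that le_add_diff_inverse2 not_less rangeI)
    then show ?thesis using pochhammer_of_nat_eq_0_iff[of n p, where ?'a = complex] by simp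
  qed
  have summand: "?f (m + p) = pochhammer a (p + q) * s ^ p * (((- ?b) gchoose m) * s ^ m)" for m
  proof -
    have "pochhammer (- of_nat (m + p)) p = (- 1) ^ p * pochhammer (of_nat m + 1 :: complex) p"
      by (subst pochhammer_minus) (simp add: algebra_simps)
    moreover have "pochhammer (of_nat m + 1 :: complex) p * fact m = fact (m + p)"
      using pochhammer_product'[of "1 :: complex" m p]
      by (simp add: pochhammer_fact add.commute mult.commute)
    moreover have "pochhammer a (m + p + q) = pochhammer a (p + q) * pochhammer ?b m"
      using pochhammer_product'[of a "p + q" m] by (simp add: algebra_simps)
    ultimately show ?thesis
      by (simp add: gbinomial_pochhammer power_add field_simps flip: power_mult_distrib)
  qed
  have "(\<lambda>m. ((- ?b) gchoose m) * s ^ m) sums (1 + s) powr (- ?b)"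
    using assms by (rule gen_binomial_complex)
  then have "(\<lambda>m. ?f (m + p)) sums (pochhammer a (p + q) * s ^ p * (1 + s) powr (- ?b))"
    unfolding summand by (rule sums_mult)
  moreover have "strict_mono (\<lambda>m. m + p)" by (simp add: strict_mono_def)
  ultimately have "?f sums (pochhammer a (p + q) * s ^ p * (1 + s) powr (- ?b))"
    using sums_mono_reindex[of "\<lambda>m. m + p" ?f] zero by blast
  then show ?thesis by (simp add: algebra_simps)
qed

text \<open>
  After expanding every power of \<open>1 + s\<close>, the coefficient of \<open>s^n\<close> is a double sum over
  \<open>p\<close> and \<open>q\<close> that factors into two terminating Gauss series at argument 2.
\<close>

lemma appell_F2_sums:
  assumes "norm s < 1"
  shows "(\<lambda>n. F2_coeff a k l n * s ^ n) sums
     ((1 + s) powr (- a)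
       * appell_F2 a k l (- 2 * of_nat k) (- 2 * of_nat l) (2 * s / (1 + s)) (2 / (1 + s)))"
proof -
  have s1: "1 + s \<noteq> 0"
    using assms by (metis add_eq_0_iff norm_minus_cancel norm_one order_less_irrefl)
  let ?f = "\<lambda>p q n. (- 1) ^ n / fact n * pochhammer (- of_nat n) p * pochhammer a (n + q) * s ^ n"
  define d where "d = (\<lambda>k p. pochhammer (- of_nat k) p / (pochhammer (- 2 * of_nat k) p * fact p) * 2 ^ p :: complex)"
  have S: "(\<lambda>n. \<Sum>p\<le>k. \<Sum>q\<le>l. d k p * d l q * ?f p q n) sums
    (\<Sum>p\<le>k. \<Sum>q\<le>l. d k p * d l q * (pochhammer a (p + q) * s ^ p * (1 + s) powr (- a - of_nat p - of_nat q)))"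
    by (intro sums_sum sums_mult shifted_binomial_sums assms)
  \<comment> \<open>The factorisation: the split \<open>(a)_(n+q) = (a)_n (a+n)_q\<close> decouples the two indices.\<close>
  have T: "(\<Sum>p\<le>k. \<Sum>q\<le>l. d k p * d l q * ?f p q n) = F2_coeff a k l n * s ^ n" for n
  proof -
    have "(\<Sum>p\<le>k. \<Sum>q\<le>l. d k p * d l q * ?f p q n)
      = (\<Sum>p\<le>k. \<Sum>q\<le>l. (- 1) ^ n * pochhammer a n / fact n * s ^ n * (gauss_at_2_term (- of_nat n) k p * gauss_at_2_term (a + of_nat n) l q))"
      by (intro sum.cong refl) (simp add: d_def gauss_at_2_term_def pochhammer_product' mult.commute mult.left_commute)
    also have "\<dots> = (- 1) ^ n * pochhammer a n / fact n * s ^ n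
        * ((\<Sum>p\<le>k. gauss_at_2_term (- of_nat n) k p) * (\<Sum>q\<le>l. gauss_at_2_term (a + of_nat n) l q))"
      unfolding sum_product by (simp only: sum_distrib_left)
    also have "\<dots> = F2_coeff a k l n * s ^ n"
      unfolding sum_gauss_at_2_term F2_coeff_def by (simp add: algebra_simps)
    finally show ?thesis .
  qed
  have "(1 + s) powr (- a - of_nat p - of_nat q) = (1 + s) powr (- a) / (1 + s) ^ p / (1 + s) ^ q" for p q
    using s1 by (simp add: powr_diff powr_nat')
  then have "(\<Sum>p\<le>k. \<Sum>q\<le>l. d k p * d l q * (pochhammer a (p + q) * s ^ p * (1 + s) powr (- a - of_nat p - of_nat q)))
    = (1 + s) powr (- a)
       * appell_F2 a k l (- 2 * of_nat k) (- 2 * of_nat l) (2 * s / (1 + s)) (2 / (1 + s))"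
    unfolding appell_F2_def sum_distrib_left
    by (intro sum.cong refl) (simp add: d_def divide_inverse power_mult_distrib power_inverse mult_ac)
  with S T show ?thesis by simp
qed

section \<open>Even and odd parts\<close>

text \<open>
  Both sides arise from \<open>(1/2 - m)_(k+m)\<close>, split after \<open>k\<close> or after \<open>m\<close> factors, together
  with the reflection of a rising product at \<open>1/2\<close>. This moves \<open>k\<close> into the lower parameter
  \<open>1/2 - k\<close> of the Gauss function.
\<close>

lemma pochhammer_half_minus:
  "pochhammer (1 / 2 - of_nat m :: complex) k * pochhammer (1 / 2 - of_nat k) m
     = pochhammer (1 / 2) k * pochhammer (1 / 2) m"
proof -
  have reflect: "pochhammer (1 / 2 - of_nat m + y :: complex) m = (- 1) ^ m * pochhammer (1 / 2 - y) m" for y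
    using pochhammer_minus[of "of_nat m - 1 / 2 - y" m] by (simp add: algebra_simps)
  have "pochhammer (1 / 2 - of_nat m :: complex) k * ((- 1) ^ m * pochhammer (1 / 2 - of_nat k) m)
      = pochhammer (1 / 2 - of_nat m) (k + m)"
    unfolding pochhammer_product' reflect[of "of_nat k"] by simp
  also have "\<dots> = pochhammer (1 / 2 - of_nat m) m * pochhammer (1 / 2) k"
    using pochhammer_product'[of "1 / 2 - of_nat m :: complex" m k] by (simp add: add.commute[of m k])
  also have "pochhammer (1 / 2 - of_nat m :: complex) m = (- 1) ^ m * pochhammer (1 / 2) m"
    using reflect[of 0] by simp
  finally show ?thesis by simp
qed

lemma pochhammer_half_minus_nz: "pochhammer (1 / 2 - of_nat k :: complex) m \<noteq> 0"
  using pochhammer_half_minus[of m k] pochhammer_half_nz by auto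

lemma pochhammer_even: "pochhammer a (2 * m) = 4 ^ m * pochhammer (a / 2) m * pochhammer ((a + 1) / 2 :: complex) m"
  using pochhammer_double[of "a / 2" m] by (simp add: power_mult add_divide_distrib)

lemma pochhammer_odd:
  "pochhammer a (Suc (2 * m)) = 2 * 4 ^ m * pochhammer (a / 2) (Suc m) * pochhammer ((a + 1) / 2 :: complex) m"
  unfolding pochhammer_Suc[of a] pochhammer_even pochhammer_Suc[of "a / 2"] by (simp add: field_simps)

lemma F2_coeff_even:
  "F2_coeff a k l (2 * m) = pochhammer ((a + 1) / 2) l / pochhammer (1 / 2) l
     * (pochhammer (a / 2) m * pochhammer ((a + 1) / 2 + of_nat l) m
        / (pochhammer (1 / 2 - of_nat k) m * fact m))"
proof -
  have "pochhammer ((1 - of_nat (2 * m)) / 2 :: complex) k / pochhammer (1 / 2) k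
      = pochhammer (1 / 2) m / pochhammer (1 / 2 - of_nat k) m"
  proof -
    have arg_eq: "(1 - of_nat (2 * m)) / 2 = 1 / 2 - (of_nat m :: complex)" by (simp add: diff_divide_distrib)
    show ?thesis unfolding arg_eq
      using pochhammer_half_minus[of m k] pochhammer_half_nz[of k] pochhammer_half_minus_nz[of k m]
      by (simp add: frac_eq_eq mult.commute)
  qed
  moreover have "pochhammer ((a + 1) / 2) m * pochhammer ((a + of_nat (2 * m) + 1) / 2) l
      = pochhammer ((a + 1) / 2) l * pochhammer ((a + 1) / 2 + of_nat l) m"
  proof -
    have eqs: "(a + of_nat (2 * m) + 1) / 2 = (a + 1) / 2 + of_nat m"
      by (simp add: add_divide_distrib)
    show ?thesis unfolding eqs pochhammer_product'[symmetric] by (simp only: add.commute)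
  qed
  moreover have "(fact (2 * m) :: complex) = 4 ^ m * pochhammer (1 / 2) m * fact m"
    using fact_double[of m, where ?'a = complex] by (simp add: power_mult)
  moreover have "F2_coeff a k l (2 * m)
      = 4 ^ m * pochhammer (a / 2) m / fact (2 * m)
        * (pochhammer ((1 - of_nat (2 * m)) / 2) k / pochhammer (1 / 2) k)
        * (pochhammer ((a + 1) / 2) m * pochhammer ((a + of_nat (2 * m) + 1) / 2) l)
        / pochhammer (1 / 2) l"
      proof -
    have "(- 1 :: complex) ^ (2 * m) = 1" by simp
    then show ?thesis
      unfolding F2_coeff_def pochhammer_even by (simp only: divide_inverse mult_ac mult_1 mult_1_right)
  qed
  ultimately show ?thesis
    using pochhammer_half_nz[of m] by (simp only:) (simp add: divide_simps)
qed

text \<open>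
  For odd \<open>n = 2m + 1\<close> the first quotient in the coefficient is \<open>(-m)_k / (1/2)_k\<close>. This zero is the
  reason why the odd part starts only at \<open>s^(2k+1)\<close>.
\<close>

lemma F2_coeff_odd_below:
  assumes "m < k"
  shows "F2_coeff a k l (Suc (2 * m)) = 0"
proof -
  have "(1 - of_nat (Suc (2 * m))) / 2 = - (of_nat m :: complex)" by simp
  then show ?thesis
    unfolding F2_coeff_def using assms pochhammer_of_nat_eq_0_iff[of m k, where ?'a = complex] by simp
qed

text \<open>
  With \<open>n = 2(k+j) + 1\<close> the vanishing factor is passed: \<open>(-(k+j))_k = (-1)^k (k+j)! / j!\<close>. This
  supplies the \<open>j!\<close> of the Gauss series and the sign in the third identity.
\<close>

lemma F2_coeff_odd:
  "F2_coeff a k l (Suc (2 * (k + j))) =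
     - (pochhammer ((a + 1) / 2) k * pochhammer (a / 2) (k + l + 1)
          / (pochhammer (1 / 2) k * pochhammer (1 / 2) (k + 1) * pochhammer (1 / 2) l) * (- 1) ^ k)
     * (pochhammer ((a + 1) / 2 + of_nat k) j * pochhammer (a / 2 + of_nat k + of_nat l + 1) j
        / (pochhammer (3 / 2 + of_nat k) j * fact j))"
proof -
  let ?m = "k + j"
  have f: "fact (Suc (2 * ?m)) = 2 * 4 ^ ?m * pochhammer (1 / 2 :: complex) (Suc ?m) * fact ?m"
    using pochhammer_odd[of 1 ?m] by (simp add: pochhammer_fact)
  have h: "(1 - of_nat (Suc (2 * ?m))) / 2 = - (of_nat ?m :: complex)" by simp
  have "pochhammer (- of_nat ?m :: complex) k = (- 1) ^ k * pochhammer (of_nat j + 1) k"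
    by (subst pochhammer_minus) (simp add: algebra_simps)
  moreover have "pochhammer (of_nat j + 1 :: complex) k * fact j = fact ?m"
    using pochhammer_product'[of "1 :: complex" j k]
    by (simp add: pochhammer_fact add.commute mult.commute)
  ultimately have p1: "pochhammer ((1 - of_nat (Suc (2 * ?m))) / 2 :: complex) k / fact ?m = (- 1) ^ k / fact j"
    unfolding h by (simp add: field_simps)
  have p2: "pochhammer (a / 2) (Suc ?m) * pochhammer ((a + of_nat (Suc (2 * ?m)) + 1) / 2) l
      = pochhammer (a / 2) (k + l + 1) * pochhammer (a / 2 + of_nat k + of_nat l + 1) j"
  proof -
    have eqs: "(a + of_nat (Suc (2 * ?m)) + 1) / 2 = a / 2 + of_nat (Suc ?m)"
        "a / 2 + of_nat k + of_nat l + 1 = a / 2 + of_nat (k + l + 1)" "Suc ?m + l = k + l + 1 + j"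
      by (simp_all add: add_divide_distrib)
    show ?thesis unfolding eqs(1,2) pochhammer_product'[symmetric] eqs(3) by (rule refl)
  qed
  have p3: "pochhammer ((a + 1) / 2) ?m = pochhammer ((a + 1) / 2) k * pochhammer ((a + 1) / 2 + of_nat k) j"
    by (rule pochhammer_product')
  have p4: "pochhammer (1 / 2 :: complex) (Suc ?m) = pochhammer (1 / 2) (k + 1) * pochhammer (3 / 2 + of_nat k) j"
    using pochhammer_product'[of "1 / 2 :: complex" "k + 1" j] by simp
  have "F2_coeff a k l (Suc (2 * ?m))
      = - (pochhammer (a / 2) (Suc ?m) * pochhammer ((a + of_nat (Suc (2 * ?m)) + 1) / 2) l)
        * pochhammer ((a + 1) / 2) ?m / pochhammer (1 / 2) (Suc ?m)
        * (pochhammer ((1 - of_nat (Suc (2 * ?m))) / 2) k / fact ?m)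
        / (pochhammer (1 / 2) k * pochhammer (1 / 2) l)"
  proof -
    have "(- 1 :: complex) ^ Suc (2 * ?m) = - 1" "(4 :: complex) ^ ?m \<noteq> 0" by simp_all
    then show ?thesis
      unfolding F2_coeff_def f pochhammer_odd using pochhammer_half_nz[of "Suc ?m"] by (simp only:) (simp add: divide_simps)
  qed
  then show ?thesis unfolding p1 p2 p3 p4 by (simp only: divide_inverse inverse_mult_distrib mult_ac minus_mult_left[symmetric] minus_mult_right[symmetric])
qed

lemma appell_F2_sums_uminus:
  assumes "norm s < 1"
  shows "(\<lambda>n. F2_coeff a k l n * (- s) ^ n) sums
     ((1 - s) powr (- a)
       * appell_F2 a k l (- 2 * of_nat k) (- 2 * of_nat l) (2 * s / (s - 1)) (2 / (1 - s)))"
proof -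
  have "2 * (- s) / (1 + (- s)) = 2 * s / (s - 1)"
    using minus_divide_divide[of "2 * s" "s - 1"] by simp
  then show ?thesis using appell_F2_sums[of "- s" a k l] assms by simp
qed

text \<open>
  Convergence of the Gauss series is inherited from the multiplied series, because the factor is nonzero.
\<close>

lemma gauss_2F1_eqI:
  assumes "(\<lambda>n. c * (pochhammer A n * pochhammer B n / (pochhammer C n * fact n)) * z ^ n) sums x"
    and "c \<noteq> 0"
  shows "c * gauss_2F1 A B C z = x"
proof -
  have "(\<lambda>n. inverse c * (c * (pochhammer A n * pochhammer B n / (pochhammer C n * fact n)) * z ^ n))
          sums (inverse c * x)"
    using assms(1) by (rule sums_mult)
  then have "gauss_2F1 A B C z = inverse c * x"
    unfolding gauss_2F1_def using assms(2) by (simp add: sums_iff field_simps)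
  then show ?thesis using assms(2) by simp
qed

lemma pochhammer_not_Int_nz:
  assumes "b \<notin> \<int>" shows "pochhammer b n \<noteq> (0 :: complex)"
  using assms by (auto simp: pochhammer_eq_0_iff)

lemma half_not_Int:
  assumes "a \<notin> \<int>" shows "a / 2 \<notin> \<int>" "(a + 1) / 2 \<notin> (\<int> :: complex set)"
proof -
  show "a / 2 \<notin> \<int>"
    using assms Ints_mult[of 2 "a / 2"] by auto
  show "(a + 1) / 2 \<notin> \<int>"
  proof
    assume "(a + 1) / 2 \<in> \<int>"
    then have "2 * ((a + 1) / 2) - 1 \<in> \<int>" by (intro Ints_diff Ints_mult) auto
    moreover have "2 * ((a + 1) / 2) - 1 = a" by (simp add: distrib_left add_divide_distrib)
    ultimately show False using assms by (simp only:)
  qed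
qed

lemma gauss_2F1_even_part:
  assumes "a \<notin> \<int>" "norm s < 1"
  shows "pochhammer ((a + 1) / 2) l / pochhammer (1 / 2) l
          * gauss_2F1 (a / 2) ((a + 1) / 2 + of_nat l) (1 / 2 - of_nat k) (s ^ 2)
        = (1 + s) powr (- a) / 2
            * appell_F2 a k l (- 2 * of_nat k) (- 2 * of_nat l) (2 * s / (1 + s)) (2 / (1 + s))
          + (1 - s) powr (- a) / 2
            * appell_F2 a k l (- 2 * of_nat k) (- 2 * of_nat l) (2 * s / (s - 1)) (2 / (1 - s))"
    (is "?c * _ = ?P / 2 * ?X + ?M / 2 * ?Y")
proof (rule gauss_2F1_eqI)
  let ?f = "\<lambda>n. (F2_coeff a k l n * s ^ n + F2_coeff a k l n * (- s) ^ n) / 2"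
  have "?f sums ((?P * ?X + ?M * ?Y) / 2)"
    using assms by (intro sums_divide sums_add appell_F2_sums appell_F2_sums_uminus)
  then have *: "?f sums (?P / 2 * ?X + ?M / 2 * ?Y)" by (simp add: add_divide_distrib)
  have "(\<lambda>m. ?f (2 * m)) sums (?P / 2 * ?X + ?M / 2 * ?Y)"
  proof (subst sums_mono_reindex[where g = "\<lambda>m. 2 * m" and f = ?f])
    show "?f n = 0" if "n \<notin> range (\<lambda>m. 2 * m)" for n
    proof -
      have "odd n" using that by (auto elim!: evenE)
      then show ?thesis by simp
    qed
  qed (use * in \<open>auto simp: strict_mono_def\<close>)
  moreover have "?f (2 * m) = ?c * (pochhammer (a / 2) m * pochhammer ((a + 1) / 2 + of_nat l) m
        / (pochhammer (1 / 2 - of_nat k) m * fact m)) * (s ^ 2) ^ m" for m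
  proof -
    have "?f (2 * m) = F2_coeff a k l (2 * m) * (s ^ 2) ^ m" by (simp add: power_mult)
    then show ?thesis unfolding F2_coeff_even .
  qed
  ultimately show "(\<lambda>m. ?c * (pochhammer (a / 2) m * pochhammer ((a + 1) / 2 + of_nat l) m
        / (pochhammer (1 / 2 - of_nat k) m * fact m)) * (s ^ 2) ^ m) sums (?P / 2 * ?X + ?M / 2 * ?Y)"
    by (simp only:)
  show "?c \<noteq> 0"
    using pochhammer_not_Int_nz[OF half_not_Int(2)[OF assms(1)]] pochhammer_half_nz by simp
qed

lemma gauss_2F1_odd_part:
  assumes "a \<notin> \<int>" "norm s < 1"
  shows "pochhammer ((a + 1) / 2) k * pochhammer (a / 2) (k + l + 1)
          / (pochhammer (1 / 2) k * pochhammer (1 / 2) (k + 1) * pochhammer (1 / 2) l)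
          * (- 1) ^ k * s ^ (2 * k + 1)
          * gauss_2F1 ((a + 1) / 2 + of_nat k) (a / 2 + of_nat k + of_nat l + 1)
              (3 / 2 + of_nat k) (s ^ 2)
        = (1 - s) powr (- a) / 2
            * appell_F2 a k l (- 2 * of_nat k) (- 2 * of_nat l) (2 * s / (s - 1)) (2 / (1 - s))
          - (1 + s) powr (- a) / 2
            * appell_F2 a k l (- 2 * of_nat k) (- 2 * of_nat l) (2 * s / (1 + s)) (2 / (1 + s))"
    (is "?c * (- 1) ^ k * s ^ (2 * k + 1) * ?F = ?M / 2 * ?Y - ?P / 2 * ?X")
proof -
  let ?f = "\<lambda>n. (F2_coeff a k l n * (- s) ^ n - F2_coeff a k l n * s ^ n) / 2"
  have "?f sums ((?M * ?Y - ?P * ?X) / 2)"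
    using assms by (intro sums_divide sums_diff appell_F2_sums appell_F2_sums_uminus)
  then have *: "?f sums (?M / 2 * ?Y - ?P / 2 * ?X)" by (simp add: diff_divide_distrib)
  let ?g = "\<lambda>j. Suc (2 * (k + j))"
  have **: "(\<lambda>j. ?f (?g j)) sums (?M / 2 * ?Y - ?P / 2 * ?X)"
  proof (subst sums_mono_reindex[where g = ?g and f = ?f])
    \<comment> \<open>Even exponents cancel; odd exponents below \<open>2k+1\<close> have coefficient zero.\<close>
    show "?f n = 0" if "n \<notin> range ?g" for n
    proof (cases "even n")
      case False
      then obtain m where m: "n = Suc (2 * m)" by (auto elim!: oddE)
      have "m < k"
      proof (rule ccontr)
        assume "\<not> m < k"
        then have "n = ?g (m - k)" using m by simp
        then show False using that by blast
      qed
      then show ?thesis using m F2_coeff_odd_below by simp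
    qed simp
  qed (use * in \<open>auto simp: strict_mono_def\<close>)
  show ?thesis
  \<comment> \<open>The prefactor contains a power of \<open>s\<close>, so division by it needs \<open>s \<noteq> 0\<close>.\<close>
  proof (cases "s = 0")
    case True
    then have "(\<lambda>j. ?f (?g j)) = (\<lambda>j. 0)" by auto
    with ** have "(\<lambda>j. 0) sums (?M / 2 * ?Y - ?P / 2 * ?X)" by (simp only:)
    then have "?M / 2 * ?Y - ?P / 2 * ?X = 0" using sums_unique2[OF _ sums_zero] by blast
    then show ?thesis using True by simp
  next
    case False
    show ?thesis
    proof (rule gauss_2F1_eqI)
      have "?f (?g j) = ?c * (- 1) ^ k * s ^ (2 * k + 1) *
           (pochhammer ((a + 1) / 2 + of_nat k) j * pochhammer (a / 2 + of_nat k + of_nat l + 1) j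
             / (pochhammer (3 / 2 + of_nat k) j * fact j)) * (s ^ 2) ^ j" for j
      proof -
        have "?f (?g j) = - F2_coeff a k l (?g j) * (s ^ (2 * k + 1) * (s ^ 2) ^ j)"
        proof -
          have e: "s ^ ?g j = s ^ (2 * k + 1) * (s ^ 2) ^ j"
            unfolding power_mult[symmetric] power_add[symmetric] by (simp add: algebra_simps)
          have "(- s) ^ ?g j = - (s ^ ?g j)" by (rule power_minus_odd) simp
          moreover have "(c * (- x) - c * x) / 2 = - c * x" for c x :: complex
            by (simp add: field_simps)
          ultimately show ?thesis unfolding e by (simp only:)
        qed
        then show ?thesis unfolding F2_coeff_odd by (simp only: divide_inverse inverse_mult_distrib mult_ac minus_mult_left[symmetric] minus_mult_right[symmetric] minus_minus)
      qed
      with ** show "(\<lambda>j. ?c * (- 1) ^ k * s ^ (2 * k + 1) *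
           (pochhammer ((a + 1) / 2 + of_nat k) j * pochhammer (a / 2 + of_nat k + of_nat l + 1) j
             / (pochhammer (3 / 2 + of_nat k) j * fact j)) * (s ^ 2) ^ j) sums (?M / 2 * ?Y - ?P / 2 * ?X)"
        by (simp only:)
      show "?c * (- 1) ^ k * s ^ (2 * k + 1) \<noteq> 0"
        using pochhammer_not_Int_nz[OF half_not_Int(2)[OF assms(1)]]
          pochhammer_not_Int_nz[OF half_not_Int(1)[OF assms(1)]] pochhammer_half_nz False by auto
    qed
  qed
qed

section \<open>The differential equation of the F2 side\<close>

lemma pochhammer_half_shift:
  "pochhammer (x / 2) n * (x + 2 * of_nat n) = x * pochhammer ((x + 2) / 2 :: complex) n"
proof -
  have "(x + 2) / 2 = x / 2 + 1" by (simp add: add_divide_distrib)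
  then have "pochhammer (x / 2) n * (x / 2 + of_nat n) = x / 2 * pochhammer ((x + 2) / 2) n"
    using pochhammer_shift[of "x / 2" n] by (simp only:)
  moreover have "x + 2 * of_nat n = 2 * (x / 2 + of_nat n)" "x = 2 * (x / 2)" by simp_all
  ultimately show ?thesis by (metis mult.assoc mult.left_commute)
qed

text \<open>
  Passing from \<open>n\<close> to \<open>n + 2\<close> moves the arguments \<open>(1 - n) / 2\<close> and
  \<open>(a + n + 1) / 2\<close> by exactly one, so that the ratio of the coefficients is rational in \<open>n\<close>.
\<close>

lemma F2_coeff_recurrence:
  "(of_nat n + 2) * (of_nat n + 1 - 2 * of_nat k) * F2_coeff a k l (n + 2)
     = (a + of_nat n) * (a + of_nat n + 1 + 2 * of_nat l) * F2_coeff a k l n"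
proof -
  let ?n = "of_nat n :: complex"
  let ?h = "pochhammer ((1 - ?n) / 2) k" and ?h' = "pochhammer ((1 - of_nat (n + 2)) / 2 :: complex) k"
  let ?g = "pochhammer ((a + ?n + 1) / 2) l" and ?g' = "pochhammer ((a + of_nat (n + 2) + 1) / 2) l"
  let ?K = "(- 1) ^ n * pochhammer a n / (fact n * pochhammer (1 / 2) k * pochhammer (1 / 2) l)"
  have n1: "?n + 1 \<noteq> 0" "?n + 2 \<noteq> 0"
    by (rule of_nat_add_one_nz) (metis of_nat_add of_nat_numeral of_nat_eq_0_iff add_is_0 zero_neq_numeral)
  have "?h' * (1 - of_nat (n + 2) + 2 * of_nat k) = (1 - of_nat (n + 2)) * ?h"
    using pochhammer_half_shift[of "1 - of_nat (n + 2)" k] by (simp only: of_nat_add of_nat_numeral diff_diff_eq[symmetric] diff_add_cancel)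
  then have h: "(?n + 1 - 2 * of_nat k) * ?h' = (?n + 1) * ?h"
    by (simp only: of_nat_add of_nat_numeral) algebra
  have "?g * (a + ?n + 1 + 2 * of_nat l) = (a + ?n + 1) * ?g'"
    using pochhammer_half_shift[of "a + ?n + 1" l] by (simp add: add_ac)
  then have g: "(a + ?n + 1) * ?g' = (a + ?n + 1 + 2 * of_nat l) * ?g"
    by (simp only: mult.commute)
  have p: "pochhammer a (n + 2) = pochhammer a n * (a + ?n) * (a + ?n + 1)"
    by (simp add: pochhammer_Suc numeral_2_eq_2 add_ac)
  have f: "(fact (n + 2) :: complex) = (?n + 2) * (?n + 1) * fact n"
    by (simp add: numeral_2_eq_2 algebra_simps)
  have "F2_coeff a k l (n + 2) = (- 1) ^ n * (pochhammer a n * (a + ?n) * (a + ?n + 1))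
      / ((?n + 2) * (?n + 1) * fact n) * (?h' / pochhammer (1 / 2) k) * (?g' / pochhammer (1 / 2) l)"
    unfolding F2_coeff_def p f by simp
  also have "\<dots> = ?K * (a + ?n) * ((a + ?n + 1) * ?g') * ?h' / ((?n + 2) * (?n + 1))"
    by (simp only: divide_inverse inverse_mult_distrib mult_ac)
  finally have F2_quot: "F2_coeff a k l (n + 2)
      = ?K * (a + ?n) * ((a + ?n + 1) * ?g') * ?h' / ((?n + 2) * (?n + 1))" .
  have "(?n + 2) * (?n + 1) \<noteq> 0" using n1 by simp
  then have F2: "(?n + 2) * (?n + 1) * F2_coeff a k l (n + 2)
      = ?K * (a + ?n) * ((a + ?n + 1) * ?g') * ?h'"
    unfolding F2_quot times_divide_eq_right by (rule nonzero_mult_div_cancel_left)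
  have F0: "F2_coeff a k l n = ?K * ?h * ?g"
    unfolding F2_coeff_def by (simp only: divide_inverse inverse_mult_distrib mult_ac)
  have "(?n + 1) * ((?n + 2) * (?n + 1 - 2 * of_nat k) * F2_coeff a k l (n + 2))
     = (?n + 1 - 2 * of_nat k) * ((?n + 2) * (?n + 1) * F2_coeff a k l (n + 2))"
    by (simp only: mult_ac)
  also have "\<dots> = ?K * (a + ?n) * ((a + ?n + 1) * ?g') * ((?n + 1 - 2 * of_nat k) * ?h')"
    unfolding F2 by (simp only: mult_ac)
  also have "\<dots> = (?n + 1) * ((a + ?n) * (a + ?n + 1 + 2 * of_nat l) * F2_coeff a k l n)"
    unfolding g h F0 by (simp only: mult_ac)
  finally show ?thesis using n1(1) by (metis mult_left_cancel)
qed

text \<open>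
  With \<open>\<theta> = s d/ds\<close> this is \<open>\<theta>(\<theta> - 2k - 1) - s^2 (\<theta> + a)(\<theta> + a + 1 + 2l)\<close>, applied to a function
  with value \<open>y0\<close> and first two derivatives \<open>y1\<close>, \<open>y2\<close> at \<open>s\<close>. Taking the values as
  arguments makes changes of variable and of gauge purely algebraic.
\<close>

definition s_operator :: "complex \<Rightarrow> nat \<Rightarrow> nat \<Rightarrow> complex \<Rightarrow> complex \<Rightarrow> complex \<Rightarrow> complex \<Rightarrow> complex" where
  "s_operator a k l s y0 y1 y2 = s ^ 2 * (1 - s ^ 2) * y2
     - s * (2 * of_nat k + (2 * a + 2 + 2 * of_nat l) * s ^ 2) * y1
     - s ^ 2 * (a * (a + 1 + 2 * of_nat l)) * y0"

text \<open>
  The two-term recurrence, read coefficientwise, is the differential equation. The recurrence does not reach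
  the coefficient of \<open>s^1\<close>, where the operator contributes \<open>-2k f(1)\<close>.
\<close>

lemma s_ode_of_recurrence:
  fixes f :: "nat \<Rightarrow> complex"
  assumes exp: "g has_fps_expansion Abs_fps f"
    and rec: "\<And>n. (of_nat n + 2) * (of_nat n + 1 - 2 * of_nat k) * f (n + 2)
     = (a + of_nat n) * (a + of_nat n + 1 + 2 * of_nat l) * f n"
    and odd: "of_nat k * f 1 = 0"
  shows "\<forall>\<^sub>F s in nhds 0. s_operator a k l s (g s) (deriv g s) (deriv (deriv g) s) = 0"
proof -
  let ?F = "Abs_fps f" and ?c1 = "2 * a + 2 + 2 * of_nat l :: complex" and ?c0 = "a * (a + 1 + 2 * of_nat l)"
  let ?E = "fps_X ^ 2 * fps_deriv (fps_deriv ?F) - fps_X ^ 4 * fps_deriv (fps_deriv ?F)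
     - fps_const (2 * of_nat k) * (fps_X * fps_deriv ?F) - fps_const ?c1 * (fps_X ^ 3 * fps_deriv ?F)
     - fps_const ?c0 * (fps_X ^ 2 * ?F)"
  have "?E $ n = 0" for n
  proof -
    consider "n = 0" | "n = 1" | "n = 2" | "n = 3" | m where "n = m + 4"
    proof -
      have "n = 0 \<or> n = 1 \<or> n = 2 \<or> n = 3 \<or> (\<exists>m. n = m + 4)" by presburger
      then show ?thesis using that by blast
    qed
    then show ?thesis
    proof cases
      case 2 then show ?thesis using odd by (simp add: fps_X_power_mult_nth)
    next
      case 3
      then have "?E $ n = 2 * f 2 - 2 * of_nat k * (2 * f 2) - ?c0 * f 0"
        by (simp add: fps_X_power_mult_nth) (simp add: numeral_2_eq_2)
      also have "\<dots> = 0" using rec[of 0] by (simp add: numeral_2_eq_2) algebra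
      finally show ?thesis .
    next
      case 4
      then have "?E $ n = 6 * f 3 - 2 * of_nat k * (3 * f 3) - ?c1 * f 1 - ?c0 * f 1"
        by (simp add: fps_X_power_mult_nth) (simp add: numeral_2_eq_2 numeral_3_eq_3)
      also have "\<dots> = 0" using rec[of 1] by (simp add: numeral_2_eq_2 numeral_3_eq_3) algebra
      finally show ?thesis .
    next
      case 5
      let ?m = "of_nat m :: complex"
      have "?E $ n = (?m + 4) * (?m + 3) * f (m + 4) - (?m + 2) * (?m + 1) * f (m + 2)
         - 2 * of_nat k * ((?m + 4) * f (m + 4)) - ?c1 * ((?m + 2) * f (m + 2)) - ?c0 * f (m + 2)"
        unfolding 5 by (simp add: fps_X_power_mult_nth eval_nat_numeral algebra_simps)
      also have "\<dots> = 0"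
      proof -
        have e: "m + 2 + 2 = m + 4" by simp
        show ?thesis using rec[of "m + 2"] unfolding e of_nat_add of_nat_numeral by algebra
      qed
      finally show ?thesis .
    qed simp
  qed
  then have E0: "?E = 0" by (simp add: fps_eq_iff)
  have "(\<lambda>s. s ^ 2 * deriv (deriv g) s - s ^ 4 * deriv (deriv g) s
     - 2 * of_nat k * (s * deriv g s) - ?c1 * (s ^ 3 * deriv g s) - ?c0 * (s ^ 2 * g s)) has_fps_expansion ?E"
    by (intro fps_expansion_intros exp)
  then have "\<forall>\<^sub>F s in nhds 0. 0 = s ^ 2 * deriv (deriv g) s - s ^ 4 * deriv (deriv g) s
     - 2 * of_nat k * (s * deriv g s) - ?c1 * (s ^ 3 * deriv g s) - ?c0 * (s ^ 2 * g s)"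
    unfolding E0 by (simp add: has_fps_expansion_def)
  then show ?thesis
    by (rule eventually_mono) (simp add: s_operator_def algebra_simps power2_eq_square power3_eq_cube power4_eq_xxxx)
qed

section \<open>Holomorphic solutions of the Gauss equation\<close>

text \<open>
  At \<open>z = 0\<close> the exponents of the hypergeometric equation are \<open>0\<close> and \<open>1 - C\<close>. If \<open>C\<close>
  is not a non-positive integer, the power-series recurrence determines every coefficient from the constant
  term.
\<close>

lemma hypergeometric_ode_unique:
  assumes holo: "W holomorphic_on ball 0 r" and r: "r > 0"
    and ode: "\<And>z. z \<in> ball 0 r \<Longrightarrow>
      z * (1 - z) * deriv (deriv W) z + (C - (A + B + 1) * z) * deriv W z - A * B * W z = 0"
    and C: "\<And>n. C + of_nat n \<noteq> 0"
  shows "\<forall>\<^sub>F z in nhds 0. W z = W 0 * gauss_2F1 A B C z"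
proof -
  define F where "F = fps_expansion W 0"
  have exp: "W has_fps_expansion F"
    unfolding F_def using holo r by (intro has_fps_expansion_fps_expansion[of "ball 0 r"]) auto
  let ?E = "fps_X * fps_deriv (fps_deriv F) - fps_X ^ 2 * fps_deriv (fps_deriv F)
     + fps_const C * fps_deriv F - fps_const (A + B + 1) * (fps_X * fps_deriv F) - fps_const (A * B) * F"
  have "(\<lambda>z. z * deriv (deriv W) z - z ^ 2 * deriv (deriv W) z + C * deriv W z
      - (A + B + 1) * (z * deriv W z) - A * B * W z) has_fps_expansion ?E"
    by (intro fps_expansion_intros exp)
  moreover have "\<forall>\<^sub>F z in nhds 0. z * deriv (deriv W) z - z ^ 2 * deriv (deriv W) z + C * deriv W z
      - (A + B + 1) * (z * deriv W z) - A * B * W z = 0"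
  proof (rule eventually_mono[OF eventually_nhds_in_open[of "ball 0 r"]])
    fix z :: complex assume "z \<in> ball 0 r"
    from ode[OF this] show "z * deriv (deriv W) z - z ^ 2 * deriv (deriv W) z + C * deriv W z
      - (A + B + 1) * (z * deriv W z) - A * B * W z = 0"
      by (simp add: algebra_simps power2_eq_square)
  qed (use r in auto)
  ultimately have "(\<lambda>_. 0) has_fps_expansion ?E"
    by (rule has_fps_expansion_cong[OF _ refl, THEN iffD1, rotated])
  then have E0: "?E = 0"
    using has_fps_expansion_0 fps_expansion_unique_complex by blast
  have step: "(of_nat n + 1) * (C + of_nat n) * F $ Suc n = (A + of_nat n) * (B + of_nat n) * F $ n" for n
  proof -
    have E: "?E $ n = 0" unfolding E0 by simp
    consider "n = 0" | "n = 1" | m where "n = m + 2"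
    proof -
      have "n = 0 \<or> n = 1 \<or> (\<exists>m. n = m + 2)" by presburger
      then show ?thesis using that by blast
    qed
    then show ?thesis
    proof cases
      case 1
      with E show ?thesis by (simp add: fps_X_power_mult_nth)
    next
      case 2
      with E show ?thesis by (simp add: fps_X_power_mult_nth numeral_2_eq_2) (simp add: algebra_simps)
    next
      case 3
      let ?m = "of_nat m :: complex"
      have "?E $ n = (?m + 2) * (?m + 3) * F $ (m + 3) - (?m + 1) * (?m + 2) * F $ (m + 2)
        + C * ((?m + 3) * F $ (m + 3)) - (A + B + 1) * ((?m + 2) * F $ (m + 2)) - A * B * F $ (m + 2)"
        unfolding 3 by (simp add: fps_X_power_mult_nth eval_nat_numeral algebra_simps)
      with E have "(?m + 3) * (C + (?m + 2)) * F $ (m + 3) = (A + (?m + 2)) * (B + (?m + 2)) * F $ (m + 2)"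
        by (simp only:) algebra
      moreover have e: "Suc (m + 2) = m + 3" by simp
      ultimately show ?thesis unfolding 3 e of_nat_add of_nat_numeral by algebra
    qed
  qed
  have coeff: "F $ n = F $ 0 * (pochhammer A n * pochhammer B n / (pochhammer C n * fact n))" for n
  proof (induction n)
    case (Suc n)
    have "of_nat n + 1 \<noteq> (0 :: complex)" by (rule of_nat_add_one_nz)
    then have "(of_nat n + 1) * (C + of_nat n) \<noteq> 0" using C[of n] by simp
    then have "F $ Suc n = (A + of_nat n) * (B + of_nat n) * F $ n / ((of_nat n + 1) * (C + of_nat n))"
      using step[of n] by (metis nonzero_mult_div_cancel_left)
    also have "\<dots> = F $ 0 * ((pochhammer A n * (A + of_nat n)) * (pochhammer B n * (B + of_nat n))
        / ((pochhammer C n * (C + of_nat n)) * ((of_nat n + 1) * fact n)))"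
      unfolding Suc by (simp only: divide_inverse inverse_mult_distrib mult_ac)
    finally show ?case by (simp add: pochhammer_Suc add.commute)
  qed simp
  have F0: "F $ 0 = W 0" using exp by (rule has_fps_expansion_imp_0_eq_fps_nth_0[symmetric])
  have "\<forall>\<^sub>F z in nhds 0. eval_fps F z = W z" using exp by (simp add: has_fps_expansion_def)
  moreover have "0 < fps_conv_radius F" using exp by (simp add: has_fps_expansion_def)
  then have "\<forall>\<^sub>F z in nhds (0::complex). z \<in> eball 0 (fps_conv_radius F)"
    by (intro eventually_nhds_in_open) (auto simp: zero_ereal_def)
  ultimately show ?thesis
  proof eventually_elim
    case (elim z)
    then have "summable (\<lambda>n. F $ n * z ^ n)"
      by (intro summable_fps) (simp add: in_eball_iff)
    show ?case
    proof (cases "W 0 = 0")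
      case True
      then have "F $ n = 0" for n using coeff F0 by simp
      then show ?thesis using elim True by (simp add: eval_fps_def)
    next
      case False
      have "summable (\<lambda>n. inverse (W 0) * (F $ n * z ^ n))"
        by (rule summable_mult) fact
      then have "summable (\<lambda>n. pochhammer A n * pochhammer B n / (pochhammer C n * fact n) * z ^ n)"
        unfolding coeff[unfolded F0] using False by (simp add: mult.assoc[symmetric])
      then have "W 0 * gauss_2F1 A B C z = eval_fps F z"
        unfolding gauss_2F1_def eval_fps_def coeff[unfolded F0]
        by (subst suminf_mult[symmetric]) (simp_all add: mult.assoc)
      then show ?thesis using elim by simp
    qed
  qed
qed

section \<open>The F3 side is a reversed F2 side\<close>

lemma pochhammer_minus_of_nat_fact:
  assumes "n \<le> m"
  shows "pochhammer (- of_nat m :: complex) n * fact (m - n) = (- 1) ^ n * fact m"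
proof -
  have "pochhammer (of_nat (m - n) + 1 :: complex) n * fact (m - n) = fact (m - n + n)"
    using pochhammer_product'[of "1 :: complex" "m - n" n]
    by (simp add: pochhammer_fact add.commute mult.commute)
  also have "m - n + n = m" using assms by simp
  finally have rising: "pochhammer (of_nat (m - n) + 1 :: complex) n * fact (m - n) = fact m" .
  have arg_eq: "(of_nat m - of_nat n + 1 :: complex) = of_nat (m - n) + 1"
    using assms by (simp add: of_nat_diff)
  show ?thesis unfolding pochhammer_minus arg_eq mult.assoc rising ..
qed

text \<open>
  Reading the sum over \<open>p\<close> backwards turns \<open>(k+1)_p (-k)_p / p!\<close> into
  \<open>(-k)_p / ((-2k)_p p!)\<close> up to a constant and a sign; both are quotients of factorials.
\<close>

lemma reversed_coefficient:
  assumes "p \<le> k"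
  shows "pochhammer (of_nat k + 1 :: complex) (k - p) * pochhammer (- of_nat k) (k - p) / fact (k - p)
       = (- 1) ^ k * (fact (2 * k) / fact k) * ((- 1) ^ p *
           (pochhammer (- of_nat k) p / (pochhammer (- 2 * of_nat k) p * fact p)))"
proof -
  have sg: "(- 1 :: complex) ^ p * (- 1) ^ p = 1" by (simp flip: power_mult_distrib)
  have "(- 1 :: complex) ^ k = (- 1) ^ (k - p) * (- 1) ^ p"
    using assms by (simp flip: power_add)
  then have s: "(- 1 :: complex) ^ (k - p) = (- 1) ^ k * (- 1) ^ p"
    by (simp only: mult.assoc sg mult_1_right)
  have "pochhammer (of_nat k + 1 :: complex) (k - p) * fact k = fact (k + (k - p))"
    using pochhammer_product'[of "1 :: complex" k "k - p"]
    by (simp add: pochhammer_fact add.commute mult.commute)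
  moreover have "k + (k - p) = 2 * k - p" using assms by simp
  ultimately have 1: "pochhammer (of_nat k + 1 :: complex) (k - p) = fact (2 * k - p) / fact k"
    by (simp add: eq_divide_eq)
  have 2: "pochhammer (- of_nat k :: complex) (k - p) = (- 1) ^ k * (- 1) ^ p * fact k / fact p"
    using pochhammer_minus_of_nat_fact[of "k - p" k] assms by (simp add: s field_simps)
  have 3: "pochhammer (- of_nat k :: complex) p = (- 1) ^ p * fact k / fact (k - p)"
    using pochhammer_minus_of_nat_fact[OF assms] by (simp add: field_simps)
  have 4: "pochhammer (- 2 * of_nat k :: complex) p = (- 1) ^ p * fact (2 * k) / fact (2 * k - p)"
    using pochhammer_minus_of_nat_fact[of p "2 * k"] assms by (simp add: field_simps)
  show ?thesis unfolding 1 2 3 4 by (simp add: divide_simps)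
qed

text \<open>
  Under the same reversal the factor \<open>1 / (c)_(p+q)\<close> of F3 becomes the factor \<open>(1-c-k-l)_(p+q)\<close> of
  F2, with signs that cancel those of the previous lemma.
\<close>

lemma reversed_denominator:
  assumes "p \<le> k" "q \<le> l"
  shows "pochhammer c (k - p + (l - q)) * ((- 1) ^ p * (- 1) ^ q * pochhammer (1 - c - of_nat k - of_nat l) (p + q))
       = pochhammer (c :: complex) (k + l)"
proof -
  let ?P = "k - p + (l - q)"
  have "k + l = ?P + (p + q)" using assms by simp
  then have "pochhammer c (k + l) = pochhammer c (?P + (p + q))" by (rule arg_cong)
  then have "pochhammer c (k + l) = pochhammer c ?P * pochhammer (c + of_nat ?P) (p + q)"
    unfolding pochhammer_product' .
  moreover have "c + of_nat ?P = - (1 - c - of_nat k - of_nat l) - of_nat (p + q) + 1"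
    using assms by (simp add: of_nat_diff)
  moreover have "pochhammer (- x - of_nat n + 1) n = (- 1) ^ n * pochhammer x n" for x :: complex and n
    using pochhammer_minus'[of "- x" n] by simp
  ultimately show ?thesis by (simp only: power_add)
qed

lemma sum_atMost_reverse: "(\<Sum>p\<le>n. f p) = (\<Sum>p\<le>n. f (n - p :: nat))"
  by (rule sum.reindex_bij_witness[of _ "\<lambda>i. n - i" "\<lambda>i. n - i"]) auto

text \<open>
  \<open>s^k F3(k+1, l+1; -k, -l; c; (s-1)/(2s), (1-s)/2)\<close> with the denominators \<open>s^p\<close> cancelled. This is a
  polynomial in \<open>s\<close>, so it makes sense at \<open>s = 0\<close> and links the regions around \<open>s = 0\<close> and
  \<open>s = 1\<close>.
\<close>

definition F3_cleared :: "complex \<Rightarrow> nat \<Rightarrow> nat \<Rightarrow> complex \<Rightarrow> complex" where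
  "F3_cleared c k l s =
     (\<Sum>p\<le>k. \<Sum>q\<le>l.
        pochhammer (of_nat k + 1) p * pochhammer (of_nat l + 1) q * pochhammer (- of_nat k) p * pochhammer (- of_nat l) q
        / (pochhammer c (p + q) * fact p * fact q) * (s ^ (k - p) * ((s - 1) / 2) ^ p * ((1 - s) / 2) ^ q))"

lemma F3_cleared_eq_appell_F3:
  assumes "s \<noteq> 0"
  shows "F3_cleared c k l s
    = s ^ k * appell_F3 (of_nat k + 1) (of_nat l + 1) k l c ((s - 1) / (2 * s)) ((1 - s) / 2)"
proof -
  have "s ^ (k - p) * ((s - 1) / 2) ^ p = s ^ k * ((s - 1) / (2 * s)) ^ p" if "p \<le> k" for p
    using assms that by (simp add: power_diff power_divide power_mult_distrib divide_simps)
  then show ?thesis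
    unfolding F3_cleared_def appell_F3_def sum_distrib_left
    by (intro sum.cong refl) simp
qed

lemma F3_cleared_at_1: "F3_cleared c k l 1 = 1"
proof -
  have "F3_cleared c k l 1 = (\<Sum>p\<le>k. \<Sum>q\<le>l. if p = 0 \<and> q = 0 then 1 else 0)"
    unfolding F3_cleared_def by (intro sum.cong refl) auto
  also have "\<dots> = (\<Sum>p\<le>k. if p = 0 then 1 else 0)"
    by (intro sum.cong refl) auto
  finally show ?thesis by simp
qed

lemma F3_cleared_holomorphic: "F3_cleared c k l holomorphic_on S"
  unfolding F3_cleared_def[abs_def] by (intro holomorphic_intros) auto

text \<open>
  The numbers \<open>2s/(s-1)\<close> and \<open>2/(1-s)\<close> are the reciprocals of the arguments of F3, as it must be
  when a terminating double series is summed in the opposite order.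
\<close>

lemma F3_cleared_eq_appell_F2:
  assumes c: "\<And>n. pochhammer c n \<noteq> 0" and s: "s \<noteq> 1"
  shows "F3_cleared c k l s
    = (- 1) ^ l * (fact (2 * k) / fact k) * (fact (2 * l) / fact l) / (pochhammer c (k + l) * 2 ^ (k + l))
      * ((1 - s) ^ (k + l) * appell_F2 (1 - c - of_nat k - of_nat l) k l (- 2 * of_nat k) (- 2 * of_nat l)
          (2 * s / (s - 1)) (2 / (1 - s)))"
proof -
  let ?a = "1 - c - of_nat k - of_nat l"
  let ?co = "\<lambda>p q. pochhammer (of_nat k + 1) p * pochhammer (of_nat l + 1) q * pochhammer (- of_nat k) p * pochhammer (- of_nat l) q
        / (pochhammer c (p + q) * fact p * fact q)"
  let ?mo = "\<lambda>p q. s ^ (k - p) * ((s - 1) / 2) ^ p * ((1 - s) / 2) ^ q"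
  let ?be = "\<lambda>p q. pochhammer ?a (p + q) * pochhammer (- of_nat k) p * pochhammer (- of_nat l) q
        / (pochhammer (- 2 * of_nat k) p * pochhammer (- 2 * of_nat l) q * fact p * fact q)"
  let ?K = "(- 1) ^ k * (- 1) ^ l * (fact (2 * k) / fact k) * (fact (2 * l) / fact l) / pochhammer c (k + l)"
  let ?M = "((s - 1) / 2) ^ k * ((1 - s) / 2) ^ l"
  have co: "?co (k - p) (l - q) = ?K * ?be p q" if "p \<le> k" "q \<le> l" for p q
  proof -
    have sg: "(- 1 :: complex) ^ n * (- 1) ^ n = 1" for n by (simp flip: power_mult_distrib)
    let ?rk = "pochhammer (- of_nat k) p / (pochhammer (- 2 * of_nat k) p * fact p) :: complex"
    let ?rl = "pochhammer (- of_nat l) q / (pochhammer (- 2 * of_nat l) q * fact q) :: complex"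
    have d: "1 / pochhammer c (k - p + (l - q)) = (- 1) ^ p * (- 1) ^ q * pochhammer ?a (p + q) / pochhammer c (k + l)"
      using reversed_denominator[OF that, of c] c[of "k + l"] c[of "k - p + (l - q)"]
      by (simp add: frac_eq_eq mult.commute)
    have "?co (k - p) (l - q)
       = (pochhammer (of_nat k + 1 :: complex) (k - p) * pochhammer (- of_nat k) (k - p) / fact (k - p))
         * (pochhammer (of_nat l + 1 :: complex) (l - q) * pochhammer (- of_nat l) (l - q) / fact (l - q))
         * (1 / pochhammer c (k - p + (l - q)))"
      by (simp only: divide_inverse inverse_mult_distrib mult_ac mult_1)
    also have "\<dots> = ((- 1) ^ p * (- 1) ^ p) * ((- 1) ^ q * (- 1) ^ q) * (?K * (pochhammer ?a (p + q) * ?rk * ?rl))"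
      unfolding reversed_coefficient[OF that(1)] reversed_coefficient[OF that(2)] d
      by (simp only: divide_inverse inverse_mult_distrib mult_ac)
    also have "\<dots> = ?K * ?be p q"
      unfolding sg by (simp only: divide_inverse inverse_mult_distrib mult_ac mult_1)
    finally show ?thesis .
  qed
  have mo: "?mo (k - p) (l - q) = ?M * ((2 * s / (s - 1)) ^ p * (2 / (1 - s)) ^ q)" if "p \<le> k" "q \<le> l" for p q
  proof -
    have nz: "(s - 1) / 2 \<noteq> 0" "(1 - s) / 2 \<noteq> 0" using s by auto
    have "?mo (k - p) (l - q) = s ^ p * (((s - 1) / 2) ^ k / ((s - 1) / 2) ^ p) * (((1 - s) / 2) ^ l / ((1 - s) / 2) ^ q)"
      using that by (simp only: power_diff[OF nz(1) that(1)] power_diff[OF nz(2) that(2)] diff_diff_cancel)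
    also have "\<dots> = ?M * ((s / ((s - 1) / 2)) ^ p * (1 / ((1 - s) / 2)) ^ q)"
      by (simp only: power_divide power_mult_distrib power_one mult_1 times_divide_eq_right times_divide_eq_left mult_1_right mult_ac divide_divide_eq_left divide_divide_eq_right)
    also have "s / ((s - 1) / 2) = 2 * s / (s - 1)" by simp
    also have "1 / ((1 - s) / 2) = 2 / (1 - s)" by simp
    finally show ?thesis .
  qed
  have "F3_cleared c k l s = (\<Sum>p\<le>k. \<Sum>q\<le>l. ?co p q * ?mo p q)"
    unfolding F3_cleared_def ..
  also have "\<dots> = (\<Sum>p\<le>k. \<Sum>q\<le>l. ?co p (l - q) * ?mo p (l - q))"
    by (rule sum.cong[OF refl]) (rule sum_atMost_reverse)
  also have "\<dots> = (\<Sum>p\<le>k. \<Sum>q\<le>l. ?co (k - p) (l - q) * ?mo (k - p) (l - q))"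
    by (rule sum_atMost_reverse)
  also have "\<dots> = (\<Sum>p\<le>k. \<Sum>q\<le>l. (?K * ?M) * (?be p q * (2 * s / (s - 1)) ^ p * (2 / (1 - s)) ^ q))"
  proof (intro sum.cong refl)
    fix p q assume "p \<in> {..k}" "q \<in> {..l}"
    then have "p \<le> k" "q \<le> l" by auto
    show "?co (k - p) (l - q) * ?mo (k - p) (l - q) = (?K * ?M) * (?be p q * (2 * s / (s - 1)) ^ p * (2 / (1 - s)) ^ q)"
      unfolding co[OF \<open>p \<le> k\<close> \<open>q \<le> l\<close>] mo[OF \<open>p \<le> k\<close> \<open>q \<le> l\<close>] by (simp only: mult_ac)
  qed
  also have "\<dots> = ?K * ?M * appell_F2 ?a k l (- 2 * of_nat k) (- 2 * of_nat l) (2 * s / (s - 1)) (2 / (1 - s))"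
    unfolding appell_F2_def sum_distrib_left ..
  also have "?M = (- 1) ^ k * (1 - s) ^ (k + l) / 2 ^ (k + l)"
  proof -
    have "(s - 1) ^ k = (- 1) ^ k * (1 - s) ^ k" by (simp flip: power_mult_distrib)
    then show ?thesis by (simp add: power_divide power_add)
  qed
  also have "?K * ((- 1) ^ k * (1 - s) ^ (k + l) / 2 ^ (k + l))
     = ((- 1) ^ k * (- 1) ^ k) * ((- 1) ^ l * (fact (2 * k) / fact k) * (fact (2 * l) / fact l)
        / (pochhammer c (k + l) * 2 ^ (k + l)) * (1 - s) ^ (k + l))"
    by (simp only: divide_inverse inverse_mult_distrib mult_ac)
  also have "(- 1 :: complex) ^ k * (- 1) ^ k = 1" by (simp flip: power_mult_distrib)
  finally show ?thesis by (simp only: mult_1 mult.assoc)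
qed

section \<open>Euler's transformation for the differential equation\<close>

text \<open>
  Euler's transformation on the level of differential equations. If \<open>m\<close> has logarithmic derivative
  \<open>r\<close> with \<open>r = -2es/(1-s^2)\<close>, that is \<open>m = const (1-s^2)^e\<close>, then \<open>m y\<close> solves the equation
  with parameter \<open>a\<close> when \<open>y\<close> solves the one with parameter \<open>-a-2k-2l\<close>. The hypotheses on
  \<open>r\<close> and its derivative \<open>r'\<close> are stated without denominators, so that the claim is a polynomial
  identity.
\<close>

lemma s_operator_gauge:
  assumes r: "r * (1 - s ^ 2) = - 2 * e * s" and r': "r' * (1 - s ^ 2) = 2 * s * r - 2 * e"
    and e: "e = - a - of_nat k - of_nat l"
  shows "s_operator a k l s (m * y0) (m * (r * y0 + y1)) (m * ((r ^ 2 + r') * y0 + 2 * r * y1 + y2))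
       = m * s_operator (- a - 2 * of_nat k - 2 * of_nat l) k l s y0 y1 y2"
proof -
  let ?D = "1 - s ^ 2" and ?b = "a + 1 + 2 * of_nat l" and ?t = "2 * a + 2 + 2 * of_nat l"
  let ?a' = "- a - 2 * of_nat k - 2 * of_nat l"
  have "s ^ 2 * ?D * (r ^ 2 + r') - s * (2 * of_nat k + ?t * s ^ 2) * r - s ^ 2 * (a * ?b)
      = s ^ 2 * (r * (r * ?D) + r' * ?D) - s * (2 * of_nat k + ?t * s ^ 2) * r - s ^ 2 * (a * ?b)"
    by algebra
  also have "\<dots> = s ^ 2 * (r * (- 2 * e * s) + (2 * s * r - 2 * e))
      - s * (2 * of_nat k + ?t * s ^ 2) * r - s ^ 2 * (a * ?b)"
    unfolding r r' by (rule refl)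
  also have "\<dots> = - 2 * of_nat k * s * (r * ?D) - 2 * e * s ^ 2 - s ^ 2 * (a * ?b)"
    unfolding e by algebra
  also have "\<dots> = - (s ^ 2 * (?a' * (?a' + 1 + 2 * of_nat l)))"
    unfolding r e by algebra
  finally have y0: "s ^ 2 * ?D * (r ^ 2 + r') - s * (2 * of_nat k + ?t * s ^ 2) * r - s ^ 2 * (a * ?b)
      = - (s ^ 2 * (?a' * (?a' + 1 + 2 * of_nat l)))" .
  have "s ^ 2 * ?D * (2 * r) - s * (2 * of_nat k + ?t * s ^ 2)
      = 2 * s ^ 2 * (r * ?D) - s * (2 * of_nat k + ?t * s ^ 2)"
    by algebra
  also have "\<dots> = - (s * (2 * of_nat k + (2 * ?a' + 2 + 2 * of_nat l) * s ^ 2))"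
    unfolding r e by algebra
  finally have y1: "s ^ 2 * ?D * (2 * r) - s * (2 * of_nat k + ?t * s ^ 2)
      = - (s * (2 * of_nat k + (2 * ?a' + 2 + 2 * of_nat l) * s ^ 2))" .
  have "s_operator a k l s y0 (r * y0 + y1) ((r ^ 2 + r') * y0 + 2 * r * y1 + y2)
     = s ^ 2 * ?D * y2 + (s ^ 2 * ?D * (2 * r) - s * (2 * of_nat k + ?t * s ^ 2)) * y1
       + (s ^ 2 * ?D * (r ^ 2 + r') - s * (2 * of_nat k + ?t * s ^ 2) * r - s ^ 2 * (a * ?b)) * y0"
    unfolding s_operator_def by algebra
  also have "\<dots> = s_operator ?a' k l s y0 y1 y2"
    unfolding y0 y1 s_operator_def by algebra
  finally have "s_operator a k l s y0 (r * y0 + y1) ((r ^ 2 + r') * y0 + 2 * r * y1 + y2)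
       = s_operator ?a' k l s y0 y1 y2" .
  moreover have "s_operator a k l s (m * y0) (m * u) (m * v) = m * s_operator a k l s y0 u v" for u v
    unfolding s_operator_def by algebra
  ultimately show ?thesis by simp
qed

lemma Re_bounds_of_norm_less_1:
  assumes "norm (s :: complex) < 1" shows "- 1 < Re s" "Re s < 1"
  using assms abs_Re_le_cmod[of s] by auto

lemma complex_pos_Re_not_nonpos: "0 < Re z \<Longrightarrow> z \<notin> \<real>\<^sub>\<le>\<^sub>0"
  by (auto simp: complex_nonpos_Reals_iff)

text \<open>
  The factor is written as a product of two principal powers, because this is the form in which it arises:
  one power comes with the F2 side, the other with the F3 side.
\<close>

lemma gauge_factor_derivative:
  fixes s e :: complex
  assumes "norm s < 1"
  shows "((\<lambda>s. (1 - s) powr e * ((1 + s) / 2) powr e) has_field_derivative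
      (1 - s) powr e * ((1 + s) / 2) powr e * (- 2 * e * s / (1 - s ^ 2))) (at s)"
proof -
  note R = Re_bounds_of_norm_less_1[OF assms]
  have nz: "1 - s \<noteq> 0" "1 + s \<noteq> 0" using R by (auto simp: complex_eq_iff)
  have D: "1 - s ^ 2 = (1 - s) * (1 + s)" by algebra
  have "((\<lambda>s. (1 - s) powr e) has_field_derivative e * (1 - s) powr (e - 1) * (0 - 1)) (at s)"
    by (rule DERIV_chain2[where f = "\<lambda>z. z powr e", OF has_field_derivative_powr])
       (use R in \<open>auto intro!: complex_pos_Re_not_nonpos derivative_eq_intros\<close>)
  moreover have "((\<lambda>s. ((1 + s) / 2) powr e) has_field_derivative e * ((1 + s) / 2) powr (e - 1) * (1 / 2)) (at s)"
    by (rule DERIV_chain2[where f = "\<lambda>z. z powr e", OF has_field_derivative_powr])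
       (use R in \<open>auto intro!: complex_pos_Re_not_nonpos derivative_eq_intros\<close>)
  ultimately have deriv: "((\<lambda>s. (1 - s) powr e * ((1 + s) / 2) powr e) has_field_derivative
      (e * (1 - s) powr (e - 1) * (0 - 1)) * ((1 + s) / 2) powr e
      + (e * ((1 + s) / 2) powr (e - 1) * (1 / 2)) * (1 - s) powr e) (at s)"
    by (rule DERIV_mult)
  have pw: "(1 - s) powr (e - 1) = (1 - s) powr e / (1 - s)"
      "((1 + s) / 2) powr (e - 1) = ((1 + s) / 2) powr e / ((1 + s) / 2)"
    using nz by (simp_all add: powr_diff)
  have alg: "(e * (P / u) * (0 - 1)) * Q + (e * (Q / (v / 2)) * (1 / 2)) * P = P * Q * (e * (u - v) / (u * v))"
    if "u \<noteq> 0" "v \<noteq> 0" for P Q u v :: complex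
    using that by (simp add: field_simps)
  have "e * ((1 - s) - (1 + s)) = - 2 * e * s" by algebra
  from deriv[unfolded pw alg[OF nz] this] show ?thesis unfolding D .
qed

lemma gauge_log_derivative:
  fixes s e :: complex
  assumes "norm s < 1"
  shows "((\<lambda>s. - 2 * e * s / (1 - s ^ 2)) has_field_derivative
      (2 * s * (- 2 * e * s / (1 - s ^ 2)) - 2 * e) / (1 - s ^ 2)) (at s)"
proof -
  note R = Re_bounds_of_norm_less_1[OF assms]
  have "1 - s \<noteq> 0" "1 + s \<noteq> 0" using R by (auto simp: complex_eq_iff)
  moreover have D: "1 - s ^ 2 = (1 - s) * (1 + s)" by algebra
  ultimately have nz: "1 - s ^ 2 \<noteq> 0" by simp
  have "((\<lambda>s. - 2 * e * s) has_field_derivative - 2 * e) (at s)"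
      "((\<lambda>s. 1 - s ^ 2) has_field_derivative - (2 * s)) (at s)"
    by (auto intro!: derivative_eq_intros)
  then have "((\<lambda>s. - 2 * e * s / (1 - s ^ 2)) has_field_derivative
      ((- 2 * e) * (1 - s ^ 2) - (- 2 * e * s) * (- (2 * s))) / ((1 - s ^ 2) * (1 - s ^ 2))) (at s)"
    by (rule DERIV_divide) (rule nz)
  moreover have "((- 2 * e) * D - (- 2 * e * s) * (- (2 * s))) / (D * D) = (2 * s * (- 2 * e * s / D) - 2 * e) / D"
    if "D \<noteq> 0" for D
  proof -
    have "(2 * s * (- 2 * e * s / D) - 2 * e) / D = ((2 * s * (- 2 * e * s) - 2 * e * D) / D) / D"
      using that by (simp add: diff_divide_distrib)
    also have "2 * s * (- 2 * e * s) - 2 * e * D = (- 2 * e) * D - (- 2 * e * s) * (- (2 * s))" by algebra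
    finally show ?thesis by simp
  qed
  ultimately show ?thesis using nz by (simp only: not_False_eq_True)
qed

lemma s_operator_gauge_deriv:
  assumes g: "g holomorphic_on ball 0 1" and s: "s \<in> ball 0 1"
    and e: "e = - a - of_nat k - of_nat l"
    and y: "\<And>s. s \<in> ball 0 1 \<Longrightarrow> y s = K * ((1 - s) powr e * ((1 + s) / 2) powr e) * g s"
  shows "s_operator a k l s (y s) (deriv y s) (deriv (deriv y) s)
    = K * ((1 - s) powr e * ((1 + s) / 2) powr e)
      * s_operator (- a - 2 * of_nat k - 2 * of_nat l) k l s (g s) (deriv g s) (deriv (deriv g) s)"
proof -
  define m where "m = (\<lambda>s. (1 - s) powr e * ((1 + s) / 2) powr e)"
  define r where "r = (\<lambda>s. - 2 * e * s / (1 - s ^ 2))"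
  define r' where "r' = (\<lambda>s. (2 * s * r s - 2 * e) / (1 - s ^ 2))"
  have dm: "(m has_field_derivative m s * r s) (at s)" if "s \<in> ball 0 1" for s
    using gauge_factor_derivative[of s e] that unfolding m_def r_def by simp
  have dr: "(r has_field_derivative r' s) (at s)" if "s \<in> ball 0 1" for s
    using gauge_log_derivative[of s e] that unfolding r'_def r_def by simp
  have dg: "(g has_field_derivative deriv g s) (at s)" if "s \<in> ball 0 1" for s
    using holomorphic_derivI[OF g open_ball that] .
  have ddg: "(deriv g has_field_derivative deriv (deriv g) s) (at s)" if "s \<in> ball 0 1" for s
    using holomorphic_derivI[OF holomorphic_deriv[OF g open_ball] open_ball that] .
  have "(y has_field_derivative K * m s * (r s * g s + deriv g s)) (at s)" if "s \<in> ball 0 1" for s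
  proof (rule has_field_derivative_transform_within_open[OF _ open_ball that])
    show "((\<lambda>s. K * m s * g s) has_field_derivative K * m s * (r s * g s + deriv g s)) (at s)"
      by (rule derivative_eq_intros dm[OF that] dg[OF that] refl)+ (simp add: algebra_simps)
    show "K * m z * g z = y z" if "z \<in> ball 0 1" for z using y[OF that] unfolding m_def by simp
  qed
  then have y1: "deriv y s = K * m s * (r s * g s + deriv g s)" if "s \<in> ball 0 1" for s
    using that by (intro DERIV_imp_deriv) auto
  have "(deriv y has_field_derivative
      K * m s * (((r s) ^ 2 + r' s) * g s + 2 * r s * deriv g s + deriv (deriv g) s)) (at s)"
  proof (rule has_field_derivative_transform_within_open[OF _ open_ball s])
    show "((\<lambda>s. K * m s * (r s * g s + deriv g s)) has_field_derivative
        K * m s * (((r s) ^ 2 + r' s) * g s + 2 * r s * deriv g s + deriv (deriv g) s)) (at s)"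
      by (rule derivative_eq_intros dm[OF s] dg[OF s] dr[OF s] ddg[OF s] refl)+
         (simp add: algebra_simps power2_eq_square)
  qed (simp add: y1)
  then have y2: "deriv (deriv y) s
      = K * m s * (((r s) ^ 2 + r' s) * g s + 2 * r s * deriv g s + deriv (deriv g) s)"
    by (rule DERIV_imp_deriv)
  have R: "- 1 < Re s" "Re s < 1" using Re_bounds_of_norm_less_1[of s] s by auto
  have "1 - s \<noteq> 0" "1 + s \<noteq> 0" using R by (auto simp: complex_eq_iff)
  moreover have "1 - s ^ 2 = (1 - s) * (1 + s)" by algebra
  ultimately have nz: "1 - s ^ 2 \<noteq> 0" by simp
  have y0: "y s = K * m s * g s" using y[OF s] unfolding m_def .
  have "s_operator a k l s (y s) (deriv y s) (deriv (deriv y) s)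
    = K * m s * s_operator (- a - 2 * of_nat k - 2 * of_nat l) k l s (g s) (deriv g s) (deriv (deriv g) s)"
    unfolding y0 y1[OF s] y2
    by (rule s_operator_gauge[OF _ _ e]) (use nz in \<open>simp_all add: r_def r'_def\<close>)
  then show ?thesis unfolding m_def .
qed

section \<open>The F3 side near s = 1\<close>

text \<open>
  The right-hand side of the first identity as a function of \<open>s = \<surd>z\<close>, extended to the half-plane
  \<open>Re s > -1\<close>.
\<close>

definition F3_side :: "complex \<Rightarrow> nat \<Rightarrow> nat \<Rightarrow> complex \<Rightarrow> complex" where
  "F3_side a k l s = ((1 + s) / 2) powr (- a - of_nat k - of_nat l)
     * F3_cleared (a + of_nat k + of_nat l + 1) k l s"

lemma F3_side_holomorphic: "F3_side a k l holomorphic_on {s. - 1 < Re s}"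
  unfolding F3_side_def[abs_def]
  by (intro holomorphic_intros F3_cleared_holomorphic) (auto intro!: complex_pos_Re_not_nonpos)

text \<open>
  On the unit disc the function is a constant multiple of \<open>(1-s^2)^(-a-k-l)\<close> times the explicit power series
  belonging to \<open>-a-2k-2l\<close>, evaluated at \<open>-s\<close>. Hence the equation holds near \<open>s = 0\<close>, and by
  the identity theorem it persists on the half-plane, which contains \<open>s = 1\<close>.
\<close>

lemma F3_side_s_ode:
  assumes a: "a \<notin> \<int>" and s: "- 1 < Re s"
  shows "s_operator a k l s (F3_side a k l s) (deriv (F3_side a k l) s) (deriv (deriv (F3_side a k l)) s) = 0"
proof -
  let ?H = "{s. - 1 < Re s}"
  let ?y = "F3_side a k l"
  define a' where "a' = - a - 2 * of_nat k - 2 * of_nat l"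
  define e where "e = - a - of_nat k - of_nat l"
  define c where "c = a + of_nat k + of_nat l + 1"
  define g where "g = (\<lambda>s. (1 - s) powr (- a')
       * appell_F2 a' k l (- 2 * of_nat k) (- 2 * of_nat l) (2 * s / (s - 1)) (2 / (1 - s)))"
  \<comment> \<open>The constant that appears when the F3 sum is read backwards.\<close>
  define K where "K = (- 1) ^ l * (fact (2 * k) / fact k) * (fact (2 * l) / fact l) / (pochhammer c (k + l) * 2 ^ (k + l))"
  have c_nz: "pochhammer c n \<noteq> 0" for n
  proof (rule pochhammer_not_Int_nz)
    show "c \<notin> \<int>"
    proof
      assume "c \<in> \<int>"
      then have "c - of_nat k - of_nat l - 1 \<in> \<int>" by (intro Ints_diff) auto
      then show False using a by (simp add: c_def)
    qed
  qed
  have ac: "a' = 1 - c - of_nat k - of_nat l" by (simp add: a'_def c_def)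
  have ball: "Re z < 1" "- 1 < Re z" if "z \<in> ball 0 1" for z
    using Re_bounds_of_norm_less_1[of z] that by auto
  have g_holo: "g holomorphic_on ball 0 1"
    unfolding g_def appell_F2_def
  proof (intro holomorphic_intros)
    fix z :: complex assume "z \<in> ball 0 1"
    from ball[OF this] show "1 - z \<notin> \<real>\<^sub>\<le>\<^sub>0" "z - 1 \<noteq> 0" "1 - z \<noteq> 0"
      by (auto intro!: complex_pos_Re_not_nonpos simp: complex_eq_iff)
  qed
  \<comment> \<open>The power \<open>(1-z)^(k+l)\<close> from the reversal splits as \<open>(1-z)^e (1-z)^(-a')\<close>.\<close>
  have y: "?y z = K * ((1 - z) powr e * ((1 + z) / 2) powr e) * g z" if "z \<in> ball 0 1" for z
  proof -
    have z: "1 - z \<noteq> 0" using ball[OF that] by (auto simp: complex_eq_iff)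
    then have "(1 - z) powr e * (1 - z) powr (- a') = (1 - z) powr of_nat (k + l)"
      by (simp add: powr_add[symmetric] e_def a'_def add.commute)
    also have "\<dots> = (1 - z) ^ (k + l)" using z by (intro powr_nat') auto
    finally have pw: "(1 - z) ^ (k + l) = (1 - z) powr e * (1 - z) powr (- a')" ..
    have "?y z = ((1 + z) / 2) powr e * F3_cleared c k l z"
      unfolding F3_side_def e_def c_def ..
    also have "F3_cleared c k l z = K * ((1 - z) ^ (k + l) * appell_F2 a' k l (- 2 * of_nat k) (- 2 * of_nat l)
          (2 * z / (z - 1)) (2 / (1 - z)))"
      unfolding ac K_def using z by (intro F3_cleared_eq_appell_F2 c_nz) auto
    finally show ?thesis unfolding pw g_def by (simp only: mult_ac)
  qed
  have "g has_fps_expansion Abs_fps (\<lambda>n. F2_coeff a' k l n * (- 1) ^ n)"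
  proof (rule has_fps_expansionI)
    have "(\<lambda>n. Abs_fps (\<lambda>n. F2_coeff a' k l n * (- 1) ^ n) $ n * u ^ n) sums g u" if "u \<in> ball 0 1" for u
      using appell_F2_sums_uminus[of u a' k l, OF that[unfolded mem_ball dist_0_norm]] unfolding g_def
      by (simp only: fps_nth_Abs_fps mult.assoc power_mult_distrib[symmetric] mult_minus1)
    then show "\<forall>\<^sub>F u in nhds 0. (\<lambda>n. Abs_fps (\<lambda>n. F2_coeff a' k l n * (- 1) ^ n) $ n * u ^ n) sums g u"
      by (intro eventually_mono[OF eventually_nhds_in_open[of "ball 0 1"]]) auto
  qed
  then have "\<forall>\<^sub>F s in nhds 0. s_operator a' k l s (g s) (deriv g s) (deriv (deriv g) s) = 0"
  proof (rule s_ode_of_recurrence)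
    fix n
    show "(of_nat n + 2) * (of_nat n + 1 - 2 * of_nat k) * (F2_coeff a' k l (n + 2) * (- 1) ^ (n + 2)) =
         (a' + of_nat n) * (a' + of_nat n + 1 + 2 * of_nat l) * (F2_coeff a' k l n * (- 1) ^ n)"
      using F2_coeff_recurrence[of n k a' l] by (simp add: mult.assoc)
    show "of_nat k * (F2_coeff a' k l 1 * (- 1) ^ 1) = 0"
      using F2_coeff_odd_below[of 0 k a' l] by (cases "k = 0") auto
  qed
  then obtain U where U: "open U" "0 \<in> U"
      "\<And>s. s \<in> U \<Longrightarrow> s_operator a' k l s (g s) (deriv g s) (deriv (deriv g) s) = 0"
    unfolding eventually_nhds by blast
  let ?E = "\<lambda>s. s_operator a k l s (?y s) (deriv ?y s) (deriv (deriv ?y) s)"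
  have H: "open ?H" "connected ?H"
    by (simp_all add: open_halfspace_Re_gt convex_connected convex_halfspace_Re_gt)
  have "?E s = (\<lambda>_. 0) s"
  proof (rule analytic_continuation_open[of "U \<inter> ball 0 1" ?H ?E])
    show "?E holomorphic_on ?H"
      unfolding s_operator_def
      by (intro holomorphic_intros holomorphic_deriv F3_side_holomorphic H)
    show "?E z = 0" if "z \<in> U \<inter> ball 0 1" for z
    proof -
      have z: "z \<in> U" "z \<in> ball 0 1" using that by auto
      have "?E z = K * ((1 - z) powr e * ((1 + z) / 2) powr e)
          * s_operator a' k l z (g z) (deriv g z) (deriv (deriv g) z)"
        unfolding a'_def
        by (rule s_operator_gauge_deriv[where y = ?y and K = K, OF g_holo z(2) e_def y])
      then show ?thesis unfolding U(3)[OF z(1)] by simp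
    qed
    show "U \<inter> ball 0 1 \<noteq> {}" using U(2) by (auto intro!: exI[of _ 0])
    show "U \<inter> ball 0 1 \<subseteq> ?H" using ball by auto
  qed (use U H s in \<open>auto intro: open_Int\<close>)
  then show ?thesis .
qed

text \<open>
  Under \<open>z = 1 - s^2\<close> the operator becomes the Gauss operator, up to the factor \<open>4s^2\<close>. The arguments
  \<open>-2s w1\<close> and \<open>4s^2 w2 - 2 w1\<close> are the first two \<open>s\<close>-derivatives of \<open>w(1 - s^2)\<close>.
\<close>

lemma s_operator_eq_hypergeometric:
  assumes C: "C = 2 * A + of_nat k + of_nat l + 1" and B: "2 * B = 2 * A + 1 + 2 * of_nat l"
    and z: "z = 1 - s ^ 2"
  shows "s_operator (2 * A) k l s w (- 2 * s * w1) (4 * s ^ 2 * w2 - 2 * w1)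
       = 4 * s ^ 2 * (z * (1 - z) * w2 + (C - (A + B + 1) * z) * w1 - A * B * w)"
proof -
  have "s_operator (2 * A) k l s w (- 2 * s * w1) (4 * s ^ 2 * w2 - 2 * w1)
       = 2 * s ^ 2 * (2 * (z * (1 - z)) * w2 + (2 * C - (2 * A + (2 * A + 1 + 2 * of_nat l) + 2) * z) * w1
          - A * (2 * A + 1 + 2 * of_nat l) * w)"
    unfolding s_operator_def C z by algebra
  also have "\<dots> = 4 * s ^ 2 * (z * (1 - z) * w2 + (C - (A + B + 1) * z) * w1 - A * B * w)"
    unfolding B[symmetric] by algebra
  finally show ?thesis .
qed

text \<open>
  Transported to the variable \<open>z = 1 - s^2\<close>, the F3 side is a holomorphic solution of the Gauss equation with
  value 1 at the origin; there is only one.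
\<close>

lemma F3_side_eq_gauss_2F1:
  assumes a: "a \<notin> \<int>"
  shows "\<forall>\<^sub>F z in nhds 0. F3_side a k l (csqrt (1 - z))
     = gauss_2F1 (a / 2) ((a + 1) / 2 + of_nat l) (a + of_nat k + of_nat l + 1) z"
proof -
  let ?y = "F3_side a k l" and ?q = "\<lambda>z. csqrt (1 - z)"
  define A where "A = a / 2"
  define B where "B = (a + 1) / 2 + of_nat l"
  define C where "C = a + of_nat k + of_nat l + 1"
  define W where "W = (\<lambda>z. ?y (?q z))"
  let ?H = "{s. - 1 < Re s}"
  have H: "open ?H" by (simp add: open_halfspace_Re_gt)
  have q: "?q z \<in> ?H" "?q z \<noteq> 0" "?q z ^ 2 = 1 - z" and dq: "(?q has_field_derivative - 1 / (2 * ?q z)) (at z)"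
    if "z \<in> ball 0 1" for z
  proof -
    have R: "0 < Re (1 - z)" using Re_bounds_of_norm_less_1[of z] that by auto
    show "?q z \<in> ?H" using Re_csqrt[of "1 - z"] by (simp add: less_le_trans[of _ 0])
    show "?q z \<noteq> 0" using R by auto
    show "?q z ^ 2 = 1 - z" by simp
    show "(?q has_field_derivative - 1 / (2 * ?q z)) (at z)"
      by (rule derivative_eq_intros complex_pos_Re_not_nonpos R refl)+ simp
  qed
  have dy: "(?y has_field_derivative deriv ?y s) (at s)" if "s \<in> ?H" for s
    using holomorphic_derivI[OF F3_side_holomorphic H that] .
  have ddy: "(deriv ?y has_field_derivative deriv (deriv ?y) s) (at s)" if "s \<in> ?H" for s
    using holomorphic_derivI[OF holomorphic_deriv[OF F3_side_holomorphic H] H that] .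
  have dW: "(W has_field_derivative deriv ?y (?q z) * (- 1 / (2 * ?q z))) (at z)" if "z \<in> ball 0 1" for z
    unfolding W_def by (rule DERIV_chain2[OF dy[OF q(1)[OF that]] dq[OF that]])
  then have W1: "deriv W z = deriv ?y (?q z) * (- 1 / (2 * ?q z))" if "z \<in> ball 0 1" for z
    using that by (intro DERIV_imp_deriv) auto
  have W2: "deriv (deriv W) z = deriv (deriv ?y) (?q z) / (4 * ?q z ^ 2) - deriv ?y (?q z) / (4 * ?q z ^ 3)"
    if z: "z \<in> ball 0 1" for z
  proof (rule DERIV_imp_deriv, rule has_field_derivative_transform_within_open[OF _ open_ball z])
    have "((\<lambda>z. deriv ?y (?q z)) has_field_derivative deriv (deriv ?y) (?q z) * (- 1 / (2 * ?q z))) (at z)"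
      by (rule DERIV_chain2[OF ddy[OF q(1)[OF z]] dq[OF z]])
    moreover have "((\<lambda>z. - 1 / (2 * ?q z)) has_field_derivative
        (0 * (2 * ?q z) - (- 1) * (2 * (- 1 / (2 * ?q z)))) / ((2 * ?q z) * (2 * ?q z))) (at z)"
      using q(2)[OF z] by (intro DERIV_divide DERIV_cmult DERIV_const dq[OF z]) simp
    ultimately have D: "((\<lambda>z. deriv ?y (?q z) * (- 1 / (2 * ?q z))) has_field_derivative
        deriv (deriv ?y) (?q z) * (- 1 / (2 * ?q z)) * (- 1 / (2 * ?q z))
        + (0 * (2 * ?q z) - (- 1) * (2 * (- 1 / (2 * ?q z)))) / ((2 * ?q z) * (2 * ?q z)) * deriv ?y (?q z)) (at z)"
      by (rule DERIV_mult)
    have eq: "d2 * (- 1 / (2 * s)) * (- 1 / (2 * s))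
        + (0 * (2 * s) - (- 1) * (2 * (- 1 / (2 * s)))) / ((2 * s) * (2 * s)) * d1
        = d2 / (4 * s ^ 2) - d1 / (4 * s ^ 3)" if "s \<noteq> 0" for s d1 d2 :: complex
      using that by (simp add: divide_simps power2_eq_square power3_eq_cube)
    show "((\<lambda>z. deriv ?y (?q z) * (- 1 / (2 * ?q z))) has_field_derivative
        deriv (deriv ?y) (?q z) / (4 * ?q z ^ 2) - deriv ?y (?q z) / (4 * ?q z ^ 3)) (at z)"
      by (rule DERIV_cong[OF D eq[OF q(2)[OF z]]])
  qed (simp add: W1)
  have "\<forall>\<^sub>F z in nhds 0. W z = W 0 * gauss_2F1 A B C z"
  proof (rule hypergeometric_ode_unique[of W 1])
    show "W holomorphic_on ball 0 1"
      unfolding holomorphic_on_open[OF open_ball] using dW by blast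
    show "C + of_nat n \<noteq> 0" for n
    proof
      assume "C + of_nat n = 0"
      then have "a = - of_nat k - of_nat l - 1 - of_nat n" unfolding C_def by algebra
      then show False using a by (auto intro!: Ints_diff)
    qed
  next
    fix z :: complex assume z: "z \<in> ball 0 1"
    let ?s = "?q z"
    note s = q[OF z]
    \<comment> \<open>Derivatives with respect to \<open>s\<close> in terms of those with respect to \<open>z\<close>.\<close>
    have d1: "deriv ?y ?s = - 2 * ?s * deriv W z"
      unfolding W1[OF z] using s(2) by (simp add: field_simps)
    have d2: "deriv (deriv ?y) ?s = 4 * ?s ^ 2 * deriv (deriv W) z - 2 * deriv W z"
      unfolding W1[OF z] W2[OF z] using s(2) by (simp add: divide_simps power2_eq_square power3_eq_cube)
    have op: "s_operator a k l ?s (W z) (- 2 * ?s * deriv W z) (4 * ?s ^ 2 * deriv (deriv W) z - 2 * deriv W z) = 0"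
      using F3_side_s_ode[OF a, of ?s k l] s(1) unfolding d1 d2 W_def by simp
    have "C = 2 * A + of_nat k + of_nat l + 1" "2 * B = 2 * A + 1 + 2 * of_nat l" "a = 2 * A" "z = 1 - ?s ^ 2"
      unfolding A_def B_def C_def s(3) by (simp_all add: distrib_left add_divide_distrib)
    note rel = this
    have "4 * ?s ^ 2 * (z * (1 - z) * deriv (deriv W) z + (C - (A + B + 1) * z) * deriv W z - A * B * W z) = 0"
      using op s_operator_eq_hypergeometric[OF rel(1,2,4)] unfolding rel(3) by simp
    then show "z * (1 - z) * deriv (deriv W) z + (C - (A + B + 1) * z) * deriv W z - A * B * W z = 0"
      using s(2) by simp
  qed simp
  moreover have "W 0 = 1" by (simp add: W_def F3_side_def F3_cleared_at_1)
  ultimately show ?thesis unfolding W_def A_def B_def C_def by simp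
qed

lemma gauss_2F1_eq_appell_F3_near_1:
  assumes "a \<notin> \<int>"
  shows "\<forall>\<^sub>F z in nhds 1.
        gauss_2F1 (a / 2) ((a + 1) / 2 + of_nat l) (a + of_nat k + of_nat l + 1) (1 - z)
        = csqrt z ^ k * ((1 + csqrt z) / 2) powr (- a - of_nat k - of_nat l)
          * appell_F3 (of_nat k + 1) (of_nat l + 1) k l (a + of_nat k + of_nat l + 1)
              ((csqrt z - 1) / (2 * csqrt z)) ((1 - csqrt z) / 2)"
proof -
  have "filterlim (\<lambda>z. 1 - z) (nhds (1 - 1)) (nhds (1 :: complex))"
    by (intro tendsto_intros filterlim_ident)
  then have "filterlim (\<lambda>z. 1 - z) (nhds 0) (nhds (1 :: complex))" by simp
  from eventually_compose_filterlim[OF F3_side_eq_gauss_2F1[OF assms] this]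
  have "\<forall>\<^sub>F z in nhds 1. F3_side a k l (csqrt z)
     = gauss_2F1 (a / 2) ((a + 1) / 2 + of_nat l) (a + of_nat k + of_nat l + 1) (1 - z)" by simp
  moreover have "\<forall>\<^sub>F z in nhds (1 :: complex). z \<noteq> 0"
    by (rule t1_space_nhds) simp
  ultimately show ?thesis
  proof eventually_elim
    case (elim z)
    then have "csqrt z \<noteq> 0" by simp
    from F3_cleared_eq_appell_F3[OF this] elim(1) show ?case
      unfolding F3_side_def by (simp only: mult_ac)
  qed
qed

section \<open>The three identities\<close>

theorem theorem3p1:
  fixes k l :: nat and a :: complex
  assumes "a \<notin> \<int>"
  shows
    "(\<forall>\<^sub>F z in nhds 1.
        gauss_2F1 (a / 2) ((a + 1) / 2 + of_nat l) (a + of_nat k + of_nat l + 1) (1 - z)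
        = csqrt z ^ k * ((1 + csqrt z) / 2) powr (- a - of_nat k - of_nat l)
          * appell_F3 (of_nat k + 1) (of_nat l + 1) k l (a + of_nat k + of_nat l + 1)
              ((csqrt z - 1) / (2 * csqrt z)) ((1 - csqrt z) / 2))
     \<and> (\<forall>\<^sub>F z in nhds 0. \<forall>s. s ^ 2 = z \<longrightarrow>
        pochhammer ((a + 1) / 2) l / pochhammer (1 / 2) l
          * gauss_2F1 (a / 2) ((a + 1) / 2 + of_nat l) (1 / 2 - of_nat k) z
        = (1 + s) powr (- a) / 2
            * appell_F2 a k l (- 2 * of_nat k) (- 2 * of_nat l) (2 * s / (1 + s)) (2 / (1 + s))
          + (1 - s) powr (- a) / 2
            * appell_F2 a k l (- 2 * of_nat k) (- 2 * of_nat l) (2 * s / (s - 1)) (2 / (1 - s)))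
     \<and> (\<forall>\<^sub>F z in nhds 0. \<forall>s. s ^ 2 = z \<longrightarrow>
        pochhammer ((a + 1) / 2) k * pochhammer (a / 2) (k + l + 1)
          / (pochhammer (1 / 2) k * pochhammer (1 / 2) (k + 1) * pochhammer (1 / 2) l)
          * (- 1) ^ k * s ^ (2 * k + 1)
          * gauss_2F1 ((a + 1) / 2 + of_nat k) (a / 2 + of_nat k + of_nat l + 1)
              (3 / 2 + of_nat k) z
        = (1 - s) powr (- a) / 2
            * appell_F2 a k l (- 2 * of_nat k) (- 2 * of_nat l) (2 * s / (s - 1)) (2 / (1 - s))
          - (1 + s) powr (- a) / 2
            * appell_F2 a k l (- 2 * of_nat k) (- 2 * of_nat l) (2 * s / (1 + s)) (2 / (1 + s)))"
proof (intro conjI)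
  have small: "\<forall>\<^sub>F z in nhds 0. norm (z :: complex) < 1"
    using eventually_nhds_in_open[of "ball (0 :: complex) 1" 0] by simp
  have root: "norm s < 1" if "s ^ 2 = z" "norm z < 1" for s z :: complex
    using that abs_square_less_1[of "norm s"] by (auto simp: norm_power)
  show "\<forall>\<^sub>F z in nhds 0. \<forall>s. s ^ 2 = z \<longrightarrow>
        pochhammer ((a + 1) / 2) l / pochhammer (1 / 2) l
          * gauss_2F1 (a / 2) ((a + 1) / 2 + of_nat l) (1 / 2 - of_nat k) z
        = (1 + s) powr (- a) / 2
            * appell_F2 a k l (- 2 * of_nat k) (- 2 * of_nat l) (2 * s / (1 + s)) (2 / (1 + s))
          + (1 - s) powr (- a) / 2
            * appell_F2 a k l (- 2 * of_nat k) (- 2 * of_nat l) (2 * s / (s - 1)) (2 / (1 - s))"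
    using small by eventually_elim (use gauss_2F1_even_part[OF assms] root in blast)
  show "\<forall>\<^sub>F z in nhds 0. \<forall>s. s ^ 2 = z \<longrightarrow>
        pochhammer ((a + 1) / 2) k * pochhammer (a / 2) (k + l + 1)
          / (pochhammer (1 / 2) k * pochhammer (1 / 2) (k + 1) * pochhammer (1 / 2) l)
          * (- 1) ^ k * s ^ (2 * k + 1)
          * gauss_2F1 ((a + 1) / 2 + of_nat k) (a / 2 + of_nat k + of_nat l + 1)
              (3 / 2 + of_nat k) z
        = (1 - s) powr (- a) / 2
            * appell_F2 a k l (- 2 * of_nat k) (- 2 * of_nat l) (2 * s / (s - 1)) (2 / (1 - s))
          - (1 + s) powr (- a) / 2
            * appell_F2 a k l (- 2 * of_nat k) (- 2 * of_nat l) (2 * s / (1 + s)) (2 / (1 + s))"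
    using small by eventually_elim (use gauss_2F1_odd_part[OF assms] root in blast)
qed (rule gauss_2F1_eq_appell_F3_near_1[OF assms])

end
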